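(* Let $\boldsymbol\alpha=(\alpha_1,\alpha_2)\in\mathbb{R}^2$ with $\alpha_k\notin\pi\mathbb{Z}$ for $k=1,2$, and let $1<p<\infty$. Then there is a constant $C>0$ such that for every $f\in S(\mathbb{R}^2)$, $$\Big\|\frac{\partial(e_{\boldsymbol\alpha}f)}{\partial y_1}\Big\|_{L^p}+\Big\|\frac{\partial(e_{\boldsymbol\alpha}f)}{\partial y_2}\Big\|_{L^p}\le C\,\Big\|e_{-\boldsymbol\alpha}(\boldsymbol y)\frac{\partial(e_{\boldsymbol\alpha}(\boldsymbol y)f(\boldsymbol y))}{\partial y_1}+i\,e_{-\boldsymbol\alpha}(\boldsymbol y)\frac{\partial(e_{\boldsymbol\alpha}(\boldsymbol y)f(\boldsymbol y))}{\partial y_2}\Big\|_{L^p}.$$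
   Context: $S(\mathbb{R}^2)$ is the Schwartz class and norms are those of $L^p(\mathbb{R}^2)$. The chirp is $e_{\boldsymbol\alpha}(\boldsymbol y)=\exp\big(\tfrac{i}{2}(y_1^2\cot\alpha_1+y_2^2\cot\alpha_2)\big)$ and $e_{-\boldsymbol\alpha}=1/e_{\boldsymbol\alpha}$. *)

theory Defs
  imports "HOL-Analysis.Analysis"
begin

definition partial_derivative :: "'n::finite \<Rightarrow> (real^'n \<Rightarrow> complex) \<Rightarrow> real^'n \<Rightarrow> complex" where
  "partial_derivative k f y = vector_derivative (\<lambda>t. f (y + t *\<^sub>R axis k 1)) (at 0)"

definition iterated_partial :: "'n::finite list \<Rightarrow> (real^'n \<Rightarrow> complex) \<Rightarrow> real^'n \<Rightarrow> complex" where
  "iterated_partial ks f = foldr partial_derivative ks f"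

text \<open>Since \<^const>\<open>vector_derivative\<close> is total, the Schwartz class must assert existence of the
  partial derivatives explicitly.  Frechet differentiability of every iterated partial derivative
  (in any order) is the same as $C^\infty$: it yields existence and continuity of all of them, and
  conversely continuous partial derivatives give Frechet differentiability.\<close>

definition schwartz :: "(real^'n::finite \<Rightarrow> complex) set" where
  "schwartz = {f.
     (\<forall>ks y. iterated_partial ks f differentiable (at y)) \<and>
     (\<forall>ks (\<beta> :: 'n \<Rightarrow> nat). \<exists>B. \<forall>y. norm ((\<Prod>j\<in>UNIV. (y $ j) ^ \<beta> j) *\<^sub>R iterated_partial ks f y) \<le> B)}"

text \<open>The norm of $L^p(\mathbf{R}^n)$ for $0 < p < \infty$, with value $\infty$ outside $L^p$
  (the power $1/p$ has to be taken in the reals, as \<^typ>\<open>ennreal\<close> has no real powers).\<close>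

definition Lp_norm :: "real \<Rightarrow> (real^'n::finite \<Rightarrow> complex) \<Rightarrow> ennreal" where
  "Lp_norm p f = (let I = (\<integral>\<^sup>+ y. ennreal (norm (f y) powr p) \<partial>lborel)
     in if I = \<infinity> then \<infinity> else ennreal (enn2real I powr (1 / p)))"

definition chirp :: "real^2 \<Rightarrow> real^2 \<Rightarrow> complex" where
  "chirp \<alpha> y = exp (\<i> / 2 * complex_of_real ((y $ 1)\<^sup>2 * cot (\<alpha> $ 1) + (y $ 2)\<^sup>2 * cot (\<alpha> $ 2)))"

definition inv_chirp :: "real^2 \<Rightarrow> real^2 \<Rightarrow> complex" where
  "inv_chirp \<alpha> y = 1 / chirp \<alpha> y"

end

theory Submission
  imports Defs "HOL-Real_Asymp.Real_Asymp"
begin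

text \<open>Multiplication by the chirp preserves the Schwartz class and its inverse has modulus 1, so the
  claim is the estimate of \<open>w = \<partial>\<^sub>1 g - i \<partial>\<^sub>2 g\<close> by \<open>u = \<partial>\<^sub>1 g + i \<partial>\<^sub>2 g\<close>, i.e. the \<open>L\<^sup>p\<close>
  boundedness of the Beurling transform.  Since \<open>\<Delta> w = (\<partial>\<^sub>1 - i \<partial>\<^sub>2)\<^sup>2 u\<close> and \<open>\<Delta>\<close> generates a random walk,
  summing \<open>\<Delta> w\<close> along the walk telescopes to w, while summing the right-hand side gives a
  martingale transform of u.  Burkholder's function yields, by duality, a Bellman function whose
  midpoint convexity bounds the bilinear form of every such transform by the \<open>L\<^sup>p\<close> and \<open>L\<^sup>q\<close> norms,
  uniformly in the step size.  Taylor expansion and the \<open>L\<^sup>2\<close> decay of differences along the walk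
  let the step size tend to 0 and the time to infinity.\<close>

section \<open>Burkholder's function and the Bellman function\<close>

text \<open>The bilinear bound sees the weights of the walk only through their modulus being at most
  1, and its right-hand side does not involve the walk at all; this is the source of the uniformity.
  A step averages twice so that summation by parts can hand one average and one difference to the
  test function; what remains at each point is exactly the midpoint inequality of the Bellman
  function. Two requirements compete in the limit. With step size t, one round of the walk deviates
  from the differential identity by O(t^3), so N rounds accumulate an error O(N t^3), whereas the
  averaged function dies out only when N t^2 is large. Hence N has to lie strictly between t^-2 and
  t^-3 in order of growth. The Bellman function yields an additive bound, with a p-th power of u and
  a q-th power of the test function, rather than a product of norms. A rescaling makes the
  coefficient of the second term 1/2, and for the extremal test function that term is half of the
  quantity being estimated and is absorbed. Sharp constants are not sought.\<close>

definition burk_block :: "real \<Rightarrow> real \<Rightarrow> real" where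
  "burk_block x z = (if \<bar>x\<bar> + \<bar>z\<bar> \<le> 1 then z\<^sup>2 - x\<^sup>2 else 1 - 2 * \<bar>x\<bar>)"

text \<open>Inside the diamond |x| + |z| <= 1 one has z^2 <= (1 - |x|)^2. So the outer branch, which
  is concave and depends on x alone, is a global majorant.\<close>

lemma burk_block_le: "burk_block x z \<le> 1 - 2 * \<bar>x\<bar>"
proof -
  have "z\<^sup>2 \<le> (1 - \<bar>x\<bar>)\<^sup>2" if "\<bar>x\<bar> + \<bar>z\<bar> \<le> 1"
    using power_mono[of "\<bar>z\<bar>" "1 - \<bar>x\<bar>" 2] that by simp
  then show ?thesis
    by (auto simp: burk_block_def power2_diff)
qed

text \<open>The right-hand side is the tangent plane of z^2 - x^2 at (x, z). Along admissible
  increments it falls by at most 2 (|z| + x) <= 2 per unit of x', and 2 is the rate at which the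
  outer branch falls.\<close>

lemma burk_block_tangent_aux:
  fixes x z x' z' :: real
  assumes v: "\<bar>x\<bar> + \<bar>z\<bar> \<le> 1" and d: "\<bar>z' - z\<bar> \<le> \<bar>x' - x\<bar>" and x': "x' > 1"
  shows "1 - 2 * x' \<le> 2 * z * z' - 2 * x * x' - z\<^sup>2 + x\<^sup>2"
proof -
  define a where "a = \<bar>z\<bar> + x"
  have a: "a \<le> 1" using v by (auto simp: a_def)
  have "z * (z' - z) \<ge> - (\<bar>z\<bar> * (x' - x))"
  proof -
    have "\<bar>z * (z' - z)\<bar> \<le> \<bar>z\<bar> * (x' - x)"
      using d x' v by (auto simp: abs_mult intro!: mult_left_mono)
    then show ?thesis by linarith
  qed
  then have 1: "2 * z * z' - 2 * x * x' - z\<^sup>2 + x\<^sup>2 \<ge> z\<^sup>2 - x\<^sup>2 - 2 * a * (x' - x)"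
    by (simp add: a_def power2_eq_square algebra_simps)
  have 2: "z\<^sup>2 - x\<^sup>2 - 2 * a * (x' - x) - (1 - 2 * x') = (1 - a)\<^sup>2 + 2 * (1 - a) * (x' - 1)"
    using abs_mult_self_eq[of z] by (simp add: a_def power2_eq_square algebra_simps)
  have "(1 - a)\<^sup>2 + 2 * (1 - a) * (x' - 1) \<ge> 0"
    using a x' by auto
  with 1 2 show ?thesis by linarith
qed

text \<open>The form z^2 - x^2 is nonpositive on increments with |z' - z| <= |x' - x|, so there it
  stays below its own tangent plane, and for |x'| <= 1 the block lies below this form. For |x'| > 1
  the outer branch is compared with the tangent plane directly, up to the reflection of x and
  x'.\<close>

lemma burk_block_tangent:
  assumes v: "\<bar>x\<bar> + \<bar>z\<bar> \<le> 1" and d: "\<bar>z' - z\<bar> \<le> \<bar>x' - x\<bar>"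
  shows "burk_block x' z' \<le> 2 * z * z' - 2 * x * x' - z\<^sup>2 + x\<^sup>2"
proof -
  consider "x' > 1" | "x' < -1" | "\<bar>x'\<bar> \<le> 1" by linarith
  then show ?thesis
  proof cases
    case 1
    then show ?thesis
      using burk_block_tangent_aux[OF v d] burk_block_le[of x' z'] by linarith
  next
    case 2
    then show ?thesis
      using burk_block_tangent_aux[of "-x" z z' "-x'"] burk_block_le[of x' z'] v d by simp
  next
    case 3
    have "burk_block x' z' \<le> z'\<^sup>2 - x'\<^sup>2"
    proof (cases "\<bar>x'\<bar> + \<bar>z'\<bar> \<le> 1")
      case False
      then have "(1 - \<bar>x'\<bar>)\<^sup>2 \<le> \<bar>z'\<bar>\<^sup>2" using 3 by (intro power_mono) auto
      then show ?thesis using False by (simp add: burk_block_def power2_diff)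
    qed (simp add: burk_block_def)
    moreover have "(z' - z)\<^sup>2 \<le> (x' - x)\<^sup>2"
      using d by (simp add: abs_le_square_iff)
    ultimately show ?thesis by (simp add: power2_eq_square algebra_simps)
  qed
qed

text \<open>At inner points the linear terms of the two tangent bounds cancel; at outer points the
  block touches its concave majorant 1 - 2 |x|.\<close>

lemma burk_block_zigzag:
  assumes "\<bar>k\<bar> \<le> \<bar>h\<bar>"
  shows "burk_block (x + h) (z + k) + burk_block (x - h) (z - k) \<le> 2 * burk_block x z"
proof (cases "\<bar>x\<bar> + \<bar>z\<bar> \<le> 1")
  case True
  have "burk_block (x + h) (z + k) \<le> 2 * z * (z + k) - 2 * x * (x + h) - z\<^sup>2 + x\<^sup>2"
    "burk_block (x - h) (z - k) \<le> 2 * z * (z - k) - 2 * x * (x - h) - z\<^sup>2 + x\<^sup>2"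
    using assms True by (intro burk_block_tangent; simp)+
  then show ?thesis using True
    by (simp add: burk_block_def power2_eq_square algebra_simps)
next
  case False
  then have "burk_block x z = 1 - 2 * \<bar>x\<bar>" by (simp add: burk_block_def)
  moreover have "2 * \<bar>x\<bar> \<le> \<bar>x + h\<bar> + \<bar>x - h\<bar>" by linarith
  ultimately show ?thesis
    using burk_block_le[of "x + h" "z + k"] burk_block_le[of "x - h" "z - k"] by (smt (verit))
qed

text \<open>Up to a positive factor this is Burkholder's function for 1 < p < 2, with x as the
  dominating variable: for these p the constant max p q - 1, with q conjugate to p, is 1 / (p -
  1).\<close>

definition burk :: "real \<Rightarrow> real \<Rightarrow> real \<Rightarrow> real" where
  "burk p x z = (\<bar>x\<bar> + \<bar>z\<bar>) powr (p - 1) * (\<bar>z\<bar> - \<bar>x\<bar> / (p - 1))"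

text \<open>Burkholder's integral representation: dilates of the simple block, weighted by t^(p-1),
  superpose to a function of homogeneity p. The integrand is of order t^(p-2) near 0 and t^(p-3)
  near infinity, which is where 1 < p < 2 comes from.\<close>

lemma burk_has_integral:
  assumes p: "1 < p" "p < 2"
  shows "((\<lambda>t. t powr (p - 1) * burk_block (x / t) (z / t)) has_integral
      (2 / (p * (2 - p)) * burk p x z)) {0..}"
proof (cases "x = 0 \<and> z = 0")
  case True
  then show ?thesis by (simp add: burk_block_def burk_def)
next
  case False
  define r where "r = \<bar>x\<bar> + \<bar>z\<bar>"
  have r: "r > 0" using False by (auto simp: r_def)
  have 1: "((\<lambda>t. t powr (p - 1) - 2 * \<bar>x\<bar> * t powr (p - 2)) has_integral
      (r powr (p - 1 + 1) / (p - 1 + 1) - 2 * \<bar>x\<bar> * (r powr (p - 2 + 1) / (p - 2 + 1)))) {0..r}"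
    using r p by (intro has_integral_diff has_integral_mult_right has_integral_powr_from_0) auto
  \<comment> \<open>For t < r the dilated point lies in the outer branch, for t >= r in the inner
    one. The endpoints, a division by zero at t = 0 and the change of branch at t = r, are discarded
    as a finite set.\<close>
  have 1: "((\<lambda>t. t powr (p - 1) * burk_block (x / t) (z / t)) has_integral
      (r powr p / p - 2 * \<bar>x\<bar> * r powr (p - 1) / (p - 1))) {0..r}"
  proof (rule has_integral_spike_finite[of "{0, r}"])
    show "((\<lambda>t. t powr (p - 1) - 2 * \<bar>x\<bar> * t powr (p - 2)) has_integral
      (r powr p / p - 2 * \<bar>x\<bar> * r powr (p - 1) / (p - 1))) {0..r}"
      using 1 by simp
    fix t assume t: "t \<in> {0..r} - {0, r}"
    then have "\<bar>x / t\<bar> + \<bar>z / t\<bar> > 1"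
      by (simp add: r_def add_divide_distrib[symmetric])
    moreover have "t powr (p - 1) = t * t powr (p - 2)"
      using t powr_add[of t 1 "p - 2"] by simp
    ultimately show "t powr (p - 1) * burk_block (x / t) (z / t) = t powr (p - 1) - 2 * \<bar>x\<bar> * t powr (p - 2)"
      using t by (simp add: burk_block_def field_simps)
  qed simp
  have "((\<lambda>t. (z\<^sup>2 - x\<^sup>2) * t powr (p - 3)) has_integral
      ((z\<^sup>2 - x\<^sup>2) * (- (r powr (p - 3 + 1)) / (p - 3 + 1)))) {r..}"
    using r p by (intro has_integral_mult_right has_integral_powr_to_inf) auto
  then have 2: "((\<lambda>t. t powr (p - 1) * burk_block (x / t) (z / t)) has_integral
      ((z\<^sup>2 - x\<^sup>2) * (- (r powr (p - 3 + 1)) / (p - 3 + 1)))) {r..}"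
  proof (rule has_integral_eq[rotated])
    fix t assume t: "t \<in> {r..}"
    then have "\<bar>x / t\<bar> + \<bar>z / t\<bar> \<le> 1"
      using r by (simp add: r_def add_divide_distrib[symmetric])
    moreover have "t powr (p - 1) = t\<^sup>2 * t powr (p - 3)"
      using t r powr_add[of t 2 "p - 3"] by simp
    ultimately show "(z\<^sup>2 - x\<^sup>2) * t powr (p - 3) = t powr (p - 1) * burk_block (x / t) (z / t)"
      using t r by (simp add: burk_block_def field_simps)
  qed
  have "((\<lambda>t. t powr (p - 1) * burk_block (x / t) (z / t)) has_integral
      (r powr p / p - 2 * \<bar>x\<bar> * r powr (p - 1) / (p - 1) +
      (z\<^sup>2 - x\<^sup>2) * (- (r powr (p - 3 + 1)) / (p - 3 + 1)))) ({0..r} \<union> {r..})"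
  proof (rule has_integral_Un[OF 1 2])
    have "{0..r} \<inter> {r..} = {r}" using r by auto
    then show "negligible ({0..r} \<inter> {r..})" by simp
  qed
  moreover have "{0..r} \<union> {r..} = {0..}" using r by auto
  moreover have "r powr p / p - 2 * \<bar>x\<bar> * r powr (p - 1) / (p - 1) +
      (z\<^sup>2 - x\<^sup>2) * (- (r powr (p - 3 + 1)) / (p - 3 + 1)) = 2 / (p * (2 - p)) * burk p x z"
  proof -
    have e: "r powr p = r powr (p - 2) * r * r" "r powr (p - 1) = r powr (p - 2) * r"
      using r powr_add[of r "p - 2" 2] powr_add[of r "p - 2" 1]
      by (simp_all add: power2_eq_square)
    have zx: "z\<^sup>2 - x\<^sup>2 = r * (\<bar>z\<bar> - \<bar>x\<bar>)"
      using abs_mult_self_eq[of z] abs_mult_self_eq[of x]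
      by (simp add: r_def power2_eq_square algebra_simps)
    have "r powr p / p - 2 * \<bar>x\<bar> * r powr (p - 1) / (p - 1) +
      (z\<^sup>2 - x\<^sup>2) * (- (r powr (p - 3 + 1)) / (p - 3 + 1))
      = r powr (p - 2) * r * (r / p - 2 * \<bar>x\<bar> / (p - 1) + (\<bar>z\<bar> - \<bar>x\<bar>) / (2 - p))"
      using p unfolding e zx by (simp add: divide_simps) (simp add: algebra_simps)
    also have "r / p - 2 * \<bar>x\<bar> / (p - 1) + (\<bar>z\<bar> - \<bar>x\<bar>) / (2 - p)
       = 2 / (p * (2 - p)) * (\<bar>z\<bar> - \<bar>x\<bar> / (p - 1))"
      using p by (simp add: r_def divide_simps) (simp add: algebra_simps)
    finally show ?thesis
      by (simp add: burk_def e r_def[symmetric])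
  qed
  ultimately show ?thesis by simp
qed

text \<open>Dilating both increments by 1 / t preserves |k| <= |h|, so the inequality for the block
  can be integrated in t.\<close>

lemma burk_zigzag:
  assumes p: "1 < p" "p < 2" and kh: "\<bar>k\<bar> \<le> \<bar>h\<bar>"
  shows "burk p (x + h) (z + k) + burk p (x - h) (z - k) \<le> 2 * burk p x z"
proof -
  let ?c = "2 / (p * (2 - p))"
  have "?c * burk p (x + h) (z + k) + ?c * burk p (x - h) (z - k) \<le> 2 * (?c * burk p x z)"
  proof (rule has_integral_le)
    show "((\<lambda>t. t powr (p - 1) * burk_block ((x + h) / t) ((z + k) / t) +
        t powr (p - 1) * burk_block ((x - h) / t) ((z - k) / t)) has_integral
        ?c * burk p (x + h) (z + k) + ?c * burk p (x - h) (z - k)) {0..}"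
      by (intro has_integral_add burk_has_integral p)
    show "((\<lambda>t. 2 * (t powr (p - 1) * burk_block (x / t) (z / t))) has_integral
        2 * (?c * burk p x z)) {0..}"
      by (intro has_integral_mult_right burk_has_integral p)
    fix t :: real assume "t \<in> {0..}"
    then have "\<bar>k / t\<bar> \<le> \<bar>h / t\<bar>" using kh by (simp add: divide_right_mono)
    from burk_block_zigzag[OF this, of "x / t" "z / t"]
    have "t powr (p - 1) * (burk_block ((x + h) / t) ((z + k) / t) + burk_block ((x - h) / t) ((z - k) / t))
      \<le> t powr (p - 1) * (2 * burk_block (x / t) (z / t))"
      by (intro mult_left_mono) (simp_all add: add_divide_distrib diff_divide_distrib)
    then show "t powr (p - 1) * burk_block ((x + h) / t) ((z + k) / t) +
        t powr (p - 1) * burk_block ((x - h) / t) ((z - k) / t)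
        \<le> 2 * (t powr (p - 1) * burk_block (x / t) (z / t))"
      by (simp add: algebra_simps)
  qed
  then have "?c * (burk p (x + h) (z + k) + burk p (x - h) (z - k)) \<le> ?c * (2 * burk p x z)"
    by (simp only: distrib_left mult.left_commute)
  moreover have "?c > 0" using p by simp
  ultimately show ?thesis
    using mult_le_cancel_left_pos by blast
qed

text \<open>For |z| >= 2 c |x| the factor |z| - c |x| is at least |z| / 2; otherwise everything is
  controlled by |x|^p. The coefficient 1/2 is matched by Young's inequality when the Bellman
  function is built.\<close>

lemma burk_lower_bound:
  assumes p: "1 < p"
  obtains C where "C \<ge> 0" "\<And>x z. burk p x z \<ge> \<bar>z\<bar> powr p / 2 - C * \<bar>x\<bar> powr p"
proof -
  define c where "c = 1 / (p - 1)"
  have c: "c > 0" using p by (simp add: c_def)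
  \<comment> \<open>Both summands serve the region |z| < 2 c |x|: the first pays for |z|^p / 2, the
    second for the negative part of \<open>burk\<close>.\<close>
  define C where "C = (2 * c) powr p / 2 + c * (2 * c + 1) powr (p - 1)"
  have "burk p x z \<ge> \<bar>z\<bar> powr p / 2 - C * \<bar>x\<bar> powr p" for x z
  proof -
    define r where "r = \<bar>x\<bar> + \<bar>z\<bar>"
    have r: "r \<ge> 0" by (simp add: r_def)
    have b: "burk p x z = r powr (p - 1) * (\<bar>z\<bar> - c * \<bar>x\<bar>)"
      by (simp add: burk_def r_def c_def)
    have pw: "y powr (p - 1) * y = y powr p" if "y \<ge> 0" for y :: real
      using that powr_add[of y "p - 1" 1] by (cases "y = 0") auto
    show ?thesis
    proof (cases "\<bar>z\<bar> \<ge> 2 * c * \<bar>x\<bar>")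
      case True
      have "\<bar>z\<bar> powr (p - 1) * (\<bar>z\<bar> / 2) \<le> r powr (p - 1) * (\<bar>z\<bar> - c * \<bar>x\<bar>)"
        using True p by (intro mult_mono powr_mono2) (auto simp: r_def)
      moreover have "C * \<bar>x\<bar> powr p \<ge> 0" using c by (simp add: C_def)
      ultimately show ?thesis using pw[of "\<bar>z\<bar>"] unfolding b by (simp add: field_simps)
    next
      case False
      have "r powr (p - 1) \<le> ((2 * c + 1) * \<bar>x\<bar>) powr (p - 1)"
        using False p by (intro powr_mono2) (auto simp: r_def algebra_simps)
      then have "r powr (p - 1) * (c * \<bar>x\<bar>) \<le> ((2 * c + 1) * \<bar>x\<bar>) powr (p - 1) * (c * \<bar>x\<bar>)"
        using c by (intro mult_right_mono) auto
      also have "\<dots> = c * (2 * c + 1) powr (p - 1) * \<bar>x\<bar> powr p"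
        using c pw[of "\<bar>x\<bar>"] by (simp add: powr_mult)
      finally have 1: "r powr (p - 1) * (c * \<bar>x\<bar>) \<le> c * (2 * c + 1) powr (p - 1) * \<bar>x\<bar> powr p" .
      have "\<bar>z\<bar> powr p \<le> (2 * c * \<bar>x\<bar>) powr p"
        using False p by (intro powr_mono2) auto
      also have "\<dots> = (2 * c) powr p * \<bar>x\<bar> powr p"
        using c by (simp add: powr_mult)
      finally have 2: "\<bar>z\<bar> powr p \<le> (2 * c) powr p * \<bar>x\<bar> powr p" .
      have 3: "r powr (p - 1) * \<bar>z\<bar> \<ge> 0" by simp
      show ?thesis unfolding b C_def distrib_right right_diff_distrib using 1 2 3 by linarith
    qed
  qed
  moreover have "C \<ge> 0" using c by (simp add: C_def)
  ultimately show ?thesis using that by blast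
qed

lemma continuous_burk:
  assumes "1 < p"
  shows "continuous_on UNIV (\<lambda>v. burk p (fst v) z)"
  unfolding burk_def using assms
  by (intro continuous_on_mult continuous_on_powr' continuous_intros) auto

section \<open>Bellman functions dual to Burkholder's function\<close>

lemma Young_scaled:
  fixes p q \<delta> :: real
  assumes pq: "1 < p" "1 < q" "1 / p + 1 / q = 1" and d: "\<delta> > 0"
  obtains K where "K \<ge> 0" "\<And>a b. a \<ge> 0 \<Longrightarrow> b \<ge> 0 \<Longrightarrow> a * b \<le> \<delta> * a powr p + K * b powr q"
proof -
  define s where "s = \<delta> powr (1 / p)"
  have s: "s > 0" "s powr p = \<delta>" using d pq by (simp_all add: s_def powr_powr)
  have "a * b \<le> \<delta> * a powr p + (1 / s) powr q * b powr q" if "a \<ge> 0" "b \<ge> 0" for a b :: real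
  proof -
    have "(s * a) * (b / s) \<le> (s * a) powr p / p + (b / s) powr q / q"
      using pq that s by (intro Youngs_inequality) auto
    also have "\<dots> \<le> (s * a) powr p + (b / s) powr q"
      using pq frac_le[of "(s * a) powr p" "(s * a) powr p" 1 p]
        frac_le[of "(b / s) powr q" "(b / s) powr q" 1 q] by simp
    also have "\<dots> = \<delta> * a powr p + (1 / s) powr q * b powr q"
      using s that by (simp add: powr_mult powr_divide)
    finally show ?thesis using s by simp
  qed
  then show ?thesis using that[of "(1 / s) powr q"] by simp
qed

text \<open>Such a function is obtained as \<open>B (x, y) = sup\<^sub>z (z * y - burk p x z)\<close>: moving the optimal z by
  \<open>\<plusminus>\<bar>h\<bar>\<close> along with \<open>x \<plusminus> h\<close> turns the zigzag concavity of burk into the gain \<open>\<bar>h * k\<bar>\<close>.\<close>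

definition bellman_fun :: "real \<Rightarrow> real \<Rightarrow> (real \<times> real \<Rightarrow> real) \<Rightarrow> bool" where
  "bellman_fun p q B \<longleftrightarrow> B \<in> borel_measurable borel \<and> (\<forall>v. 0 \<le> B v) \<and>
     (\<exists>K\<ge>0. \<forall>x y. B (x, y) \<le> K * (\<bar>x\<bar> powr p + \<bar>y\<bar> powr q)) \<and>
     (\<forall>x y h k. B (x, y) + \<bar>h * k\<bar> \<le> (B (x + h, y + k) + B (x - h, y - k)) / 2)"

text \<open>The supremum is finite because the growth of \<open>burk\<close> in z beats the linear
  term z y, and it is Borel because a supremum of continuous functions is lower
  semicontinuous.\<close>

lemma bellman_fun_exists_less_2:
  assumes p: "1 < p" "p < 2" and pq: "1 < q" "1 / p + 1 / q = 1"
  obtains B where "bellman_fun p q B"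
proof -
  obtain C where C: "C \<ge> 0" "\<And>x z. burk p x z \<ge> \<bar>z\<bar> powr p / 2 - C * \<bar>x\<bar> powr p"
    using burk_lower_bound[OF p(1)] by blast
  \<comment> \<open>The coefficient 1/2 of |z|^p cancels against the lower bound of
    \<open>burk\<close>, leaving a bound free of z.\<close>
  obtain K where K: "K \<ge> 0" "\<And>a b. a \<ge> 0 \<Longrightarrow> b \<ge> 0 \<Longrightarrow> a * b \<le> (1/2) * a powr p + K * b powr q"
    using Young_scaled[of p q "1/2"] p pq by (metis half_gt_zero_iff zero_less_one)
  define T where "T v z = z * snd v - burk p (fst v) z" for v z
  have T_le: "T v z \<le> C * \<bar>fst v\<bar> powr p + K * \<bar>snd v\<bar> powr q" for v z
  proof -
    have "z * snd v \<le> \<bar>z\<bar> * \<bar>snd v\<bar>" by (metis abs_ge_self abs_mult)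
    then show ?thesis
      using C(2)[of z "fst v"] K(2)[of "\<bar>z\<bar>" "\<bar>snd v\<bar>"] by (simp add: T_def)
  qed
  then have bdd: "bdd_above (range (T v))" for v
    by (intro bdd_aboveI[of _ "C * \<bar>fst v\<bar> powr p + K * \<bar>snd v\<bar> powr q"]) blast
  define B where "B v = (SUP z. T v z)" for v
  have le_B: "T v z \<le> B v" for v z
    unfolding B_def using bdd by (intro cSUP_upper) auto
  have meas: "B \<in> borel_measurable borel"
  proof (subst borel_measurable_iff_greater, intro allI)
    fix a :: real
    have "{v. a < B v} = (\<Union>z. {v. a < T v z})"
      using bdd by (auto simp: B_def less_cSUP_iff)
    moreover have "open {v. a < T v z}" for z
      unfolding T_def
      by (intro open_Collect_less continuous_intros continuous_burk[OF p(1)])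
    ultimately have "open {v. a < B v}" by auto
    then show "{v \<in> space borel. a < B v} \<in> sets borel" by simp
  qed
  have nonneg: "0 \<le> B v" for v
  proof -
    \<comment> \<open>For z = 0 the competitor is - \<open>burk p x 0\<close>, that is |x|^p / (p -
      1).\<close>
    have "0 \<le> T v 0" using p by (simp add: T_def burk_def mult_nonneg_nonpos2)
    then show ?thesis using le_B[of v 0] by linarith
  qed
  have upper: "B (x, y) \<le> (C + K) * (\<bar>x\<bar> powr p + \<bar>y\<bar> powr q)" for x y
  proof -
    have "B (x, y) \<le> C * \<bar>x\<bar> powr p + K * \<bar>y\<bar> powr q"
      unfolding B_def using T_le[of "(x, y)"] by (intro cSUP_least) auto
    also have "\<dots> \<le> (C + K) * \<bar>x\<bar> powr p + (C + K) * \<bar>y\<bar> powr q"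
      using C(1) K(1) by (intro add_mono mult_right_mono) auto
    finally show ?thesis by (simp add: algebra_simps)
  qed
  have conv: "B (x, y) + \<bar>h * k\<bar> \<le> (B (x + h, y + k) + B (x - h, y - k)) / 2" for x y h k
  proof -
    \<comment> \<open>The sign is chosen so that the cross term e k equals |h k|, while |e| <= |h|
      keeps (h, e) admissible for the zigzag inequality.\<close>
    define e where "e = (if k \<ge> 0 then \<bar>h\<bar> else - \<bar>h\<bar>)"
    have ek: "e * k = \<bar>h * k\<bar>" "\<bar>e\<bar> \<le> \<bar>h\<bar>"
      by (simp_all add: e_def abs_mult)
    have "T (x, y) z + \<bar>h * k\<bar> \<le> (B (x + h, y + k) + B (x - h, y - k)) / 2" for z
    proof -
      have "2 * (T (x, y) z + \<bar>h * k\<bar>) \<le> T (x + h, y + k) (z + e) + T (x - h, y - k) (z - e)"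
        using burk_zigzag[OF p ek(2), of x z] ek(1) by (simp add: T_def algebra_simps)
      also have "\<dots> \<le> B (x + h, y + k) + B (x - h, y - k)"
        by (intro add_mono le_B)
      finally show ?thesis by simp
    qed
    then have "T (x, y) z \<le> (B (x + h, y + k) + B (x - h, y - k)) / 2 - \<bar>h * k\<bar>" for z
      by (simp add: le_diff_eq)
    then have "B (x, y) \<le> (B (x + h, y + k) + B (x - h, y - k)) / 2 - \<bar>h * k\<bar>"
      unfolding B_def[of "(x, y)"] by (intro cSUP_least) auto
    then show ?thesis by linarith
  qed
  show ?thesis
    using that[of B] meas nonneg upper conv C(1) K(1)
    unfolding bellman_fun_def by (metis add_nonneg_nonneg)
qed

text \<open>The requirements are symmetric in the two arguments once the exponents are exchanged; so
  an exponent above 2 reduces to its conjugate below 2.\<close>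

lemma bellman_fun_swap:
  assumes "bellman_fun p q B"
  shows "bellman_fun q p (\<lambda>(x, y). B (y, x))"
  unfolding bellman_fun_def
proof (intro conjI allI)
  have [measurable]: "B \<in> borel_measurable (borel \<Otimes>\<^sub>M borel)"
    using assms by (simp add: bellman_fun_def borel_prod)
  have "(\<lambda>v. B (snd v, fst v)) \<in> borel_measurable (borel \<Otimes>\<^sub>M borel)"
    by measurable
  then show "(\<lambda>(x, y). B (y, x)) \<in> borel_measurable borel"
    by (simp add: case_prod_beta' borel_prod)
  show "\<exists>K\<ge>0. \<forall>x y. (case (x, y) of (x, y) \<Rightarrow> B (y, x)) \<le> K * (\<bar>x\<bar> powr q + \<bar>y\<bar> powr p)"
    using assms unfolding bellman_fun_def prod.case by (metis add.commute)
  fix x y h k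
  show "(case (x, y) of (x, y) \<Rightarrow> B (y, x)) + \<bar>h * k\<bar> \<le>
      ((case (x + h, y + k) of (x, y) \<Rightarrow> B (y, x)) + (case (x - h, y - k) of (x, y) \<Rightarrow> B (y, x))) / 2"
    using assms unfolding bellman_fun_def prod.case by (metis mult.commute)
qed (use assms in \<open>auto simp: bellman_fun_def split: prod.splits\<close>)

lemma bellman_fun_exists:
  assumes p: "1 < p" and pq: "1 < q" "1 / p + 1 / q = 1"
  obtains B where "bellman_fun p q B"
proof -
  consider "p < 2" | "p = 2" | "p > 2" by linarith
  then show ?thesis
  proof cases
    case 1
    then show ?thesis using bellman_fun_exists_less_2 assms that by blast
  next
    case 2
    with pq have q: "q = 2" by (simp add: field_simps)
    \<comment> \<open>At p = 2 the integral representation diverges at infinity, but here the gain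
      is just 2 |h k| <= h^2 + k^2.\<close>
    have "bellman_fun p q (\<lambda>(x, y). (x\<^sup>2 + y\<^sup>2) / 2)"
      unfolding bellman_fun_def
    proof (intro conjI allI)
      show "(\<lambda>(x, y). (x\<^sup>2 + y\<^sup>2) / 2 :: real) \<in> borel_measurable borel"
        by (intro borel_measurable_continuous_onI) (auto simp: case_prod_beta' intro!: continuous_intros)
      show "\<exists>K\<ge>0. \<forall>x y. (case (x, y) of (x, y) \<Rightarrow> (x\<^sup>2 + y\<^sup>2) / 2) \<le> K * (\<bar>x\<bar> powr p + \<bar>y\<bar> powr q)"
        unfolding 2 q by (intro exI[of _ 1]) (auto simp: field_simps)
      fix x y h k :: real
      have "2 * \<bar>h * k\<bar> \<le> h\<^sup>2 + k\<^sup>2"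
        using zero_le_power2[of "\<bar>h\<bar> - \<bar>k\<bar>"] by (simp add: power2_diff abs_mult)
      then have "\<bar>h * k\<bar> \<le> (h\<^sup>2 + k\<^sup>2) / 2" by simp
      moreover have "(((x + h)\<^sup>2 + (y + k)\<^sup>2) / 2 + ((x - h)\<^sup>2 + (y - k)\<^sup>2) / 2) / 2
          = (x\<^sup>2 + y\<^sup>2) / 2 + (h\<^sup>2 + k\<^sup>2) / 2"
        by (simp add: power2_eq_square field_simps)
      ultimately show "(case (x, y) of (x, y) \<Rightarrow> (x\<^sup>2 + y\<^sup>2) / 2) + \<bar>h * k\<bar> \<le>
         ((case (x + h, y + k) of (x, y) \<Rightarrow> (x\<^sup>2 + y\<^sup>2) / 2) + (case (x - h, y - k) of (x, y) \<Rightarrow> (x\<^sup>2 + y\<^sup>2) / 2)) / 2"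
        by simp
    qed auto
    then show ?thesis by (rule that)
  next
    case 3
    have "q < 2"
    proof -
      have "1 / p < 1 / 2" using 3 by (simp add: field_simps)
      then have "1 / q > 1 / 2" using pq by linarith
      then show ?thesis using pq by (simp add: field_simps)
    qed
    then obtain B where "bellman_fun q p B"
      using bellman_fun_exists_less_2[of q p] assms by (auto simp: add.commute)
    then show ?thesis using bellman_fun_swap that by blast
  qed
qed

text \<open>One copy of the real function for each pairing of real and imaginary parts: the four
  gains add up to (|Re h| + |Im h|) (|Re k| + |Im k|), which dominates |h| |k|. Measurability is
  asserted for compositions, the form in which it is applied to integrands.\<close>

lemma complex_bellman_fun_exists:
  assumes p: "1 < p" and pq: "1 < q" "1 / p + 1 / q = 1"
  obtains B :: "complex \<Rightarrow> complex \<Rightarrow> real" and K where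
    "\<And>F G M. F \<in> borel_measurable M \<Longrightarrow> G \<in> borel_measurable M \<Longrightarrow> (\<lambda>x. B (F x) (G x)) \<in> borel_measurable M"
    "\<And>u v. 0 \<le> B u v" "K \<ge> 0"
    "\<And>u v. B u v \<le> K * (cmod u powr p + cmod v powr q)"
    "\<And>u v h k. B u v + cmod h * cmod k \<le> (B (u + h) (v + k) + B (u - h) (v - k)) / 2"
proof -
  obtain B where B: "bellman_fun p q B" using bellman_fun_exists[OF assms] .
  then obtain K where K: "K \<ge> 0" "\<And>x y. B (x, y) \<le> K * (\<bar>x\<bar> powr p + \<bar>y\<bar> powr q)"
    by (auto simp: bellman_fun_def)
  have [measurable]: "B \<in> borel_measurable (borel \<Otimes>\<^sub>M borel)"
    using B by (simp add: bellman_fun_def borel_prod)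
  have nn: "0 \<le> B v" for v using B unfolding bellman_fun_def by blast
  have cv: "B (x, y) + \<bar>h * k\<bar> \<le> (B (x + h, y + k) + B (x - h, y - k)) / 2" for x y h k
    using B by (simp add: bellman_fun_def)
  define Bc where "Bc u v = B (Re u, Re v) + B (Re u, Im v) + B (Im u, Re v) + B (Im u, Im v)" for u v
  have le: "B (x, y) \<le> K * (cmod u powr p + cmod v powr q)"
    if "\<bar>x\<bar> \<le> cmod u" "\<bar>y\<bar> \<le> cmod v" for x y u v
  proof -
    have "\<bar>x\<bar> powr p \<le> cmod u powr p" "\<bar>y\<bar> powr q \<le> cmod v powr q"
      using that p pq by (auto intro: powr_mono2)
    then show ?thesis using K(2)[of x y] K(1) by (meson add_mono mult_left_mono order_trans)
  qed
  show ?thesis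
  proof (rule that[of Bc "4 * K"])
    fix F G :: "'a \<Rightarrow> complex" and M assume [measurable]: "F \<in> borel_measurable M" "G \<in> borel_measurable M"
    show "(\<lambda>x. Bc (F x) (G x)) \<in> borel_measurable M"
      unfolding Bc_def by measurable
  next
    fix u v :: complex
    show "Bc u v \<le> 4 * K * (cmod u powr p + cmod v powr q)"
      using le[of "Re u" u "Re v" v] le[of "Re u" u "Im v" v] le[of "Im u" u "Re v" v]
        le[of "Im u" u "Im v" v]
      by (simp add: Bc_def abs_Re_le_cmod abs_Im_le_cmod)
  next
    fix u v h k :: complex
    have "cmod h * cmod k \<le> (\<bar>Re h\<bar> + \<bar>Im h\<bar>) * (\<bar>Re k\<bar> + \<bar>Im k\<bar>)"
      by (intro mult_mono cmod_le) auto
    also have "\<dots> = \<bar>Re h * Re k\<bar> + \<bar>Re h * Im k\<bar> + \<bar>Im h * Re k\<bar> + \<bar>Im h * Im k\<bar>"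
      by (simp add: abs_mult algebra_simps)
    finally show "Bc u v + cmod h * cmod k \<le> (Bc (u + h) (v + k) + Bc (u - h) (v - k)) / 2"
      using cv[of "Re u" "Re v" "Re h" "Re k"] cv[of "Re u" "Im v" "Re h" "Im k"]
        cv[of "Im u" "Re v" "Im h" "Re k"] cv[of "Im u" "Im v" "Im h" "Im k"]
      by (simp add: Bc_def)
  qed (use K nn in \<open>auto simp: Bc_def intro!: add_nonneg_nonneg\<close>)
qed

section \<open>Transforms along a random walk\<close>

definition avg :: "'a::real_vector \<Rightarrow> ('a \<Rightarrow> complex) \<Rightarrow> 'a \<Rightarrow> complex" where
  "avg a F x = (F (x + a) + F (x - a)) / 2"

definition dif :: "'a::real_vector \<Rightarrow> ('a \<Rightarrow> complex) \<Rightarrow> 'a \<Rightarrow> complex" where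
  "dif a F x = (F (x + a) - F (x - a)) / 2"

lemma avg_avg: "avg a (avg a F) x = F x + dif a (dif a F) x"
  by (simp add: avg_def dif_def add_divide_distrib diff_divide_distrib)

lemma avg_commute: "avg a (avg b F) = avg b (avg a F)"
  by (auto simp: avg_def fun_eq_iff algebra_simps add_divide_distrib)

lemma avg_dif_commute: "avg a (dif b F) = dif b (avg a F)"
  by (auto simp: avg_def dif_def fun_eq_iff algebra_simps diff_divide_distrib add_divide_distrib)

lemma dif_dif: "dif a (dif a F) x = (F (x + 2 *\<^sub>R a) + F (x - 2 *\<^sub>R a) - 2 * F x) / 4"
  by (simp add: dif_def scaleR_2 algebra_simps add_divide_distrib diff_divide_distrib)

lemma avg_add: "avg a (\<lambda>x. F x + G x) = (\<lambda>x. avg a F x + avg a G x)"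
  by (auto simp: avg_def fun_eq_iff field_simps)

lemma dif_add: "dif a (\<lambda>x. F x + G x) = (\<lambda>x. dif a F x + dif a G x)"
  by (auto simp: dif_def fun_eq_iff field_simps)

lemma avg_cmult: "avg a (\<lambda>x. c * F x) = (\<lambda>x. c * avg a F x)"
  by (auto simp: avg_def fun_eq_iff field_simps)

lemma dif_cmult: "dif a (\<lambda>x. c * F x) = (\<lambda>x. c * dif a F x)"
  by (auto simp: dif_def fun_eq_iff field_simps)

lemma norm_avg_le: "(\<And>x. cmod (F x) \<le> M) \<Longrightarrow> cmod (avg a F x) \<le> M"
  unfolding avg_def using norm_triangle_ineq[of "F (x + a)" "F (x - a)"]
  by (simp add: norm_divide) (smt (verit))

lemma norm_dif_le: "(\<And>x. cmod (F x) \<le> M) \<Longrightarrow> cmod (dif a F x) \<le> M"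
  unfolding dif_def using norm_triangle_ineq4[of "F (x + a)" "F (x - a)"]
  by (simp add: norm_divide) (smt (verit))

text \<open>One step moves by 2 d, 0 or -2 d with probabilities 1/4, 1/2, 1/4. Doubling the average
  leaves one copy for the function and one for the test function.\<close>

fun avgs :: "('i \<Rightarrow> 'a::real_vector) \<Rightarrow> 'i list \<Rightarrow> ('a \<Rightarrow> complex) \<Rightarrow> 'a \<Rightarrow> complex" where
  "avgs d [] F = F"
| "avgs d (j # l) F = avgs d l (avg (d j) (avg (d j) F))"

text \<open>A discrete martingale transform along the walk with steps \<open>\<plusminus>d j\<close>: since
  avg a (avg a F) - F = dif a (dif a F), the weights \<open>\<sigma> = 1\<close> give a telescoping sum.\<close>

fun walk_transform ::
  "('i \<Rightarrow> complex) \<Rightarrow> ('i \<Rightarrow> 'a::real_vector) \<Rightarrow> 'i list \<Rightarrow> ('a \<Rightarrow> complex) \<Rightarrow> 'a \<Rightarrow> complex" where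
  "walk_transform \<sigma> d [] F = (\<lambda>x. 0)"
| "walk_transform \<sigma> d (j # l) F =
    (\<lambda>x. \<sigma> j * dif (d j) (dif (d j) F) x + walk_transform \<sigma> d l (avg (d j) (avg (d j) F)) x)"

lemma avgs_avg: "avgs d l (avg a F) = avg a (avgs d l F)"
  by (induction l arbitrary: F) (simp_all add: avg_commute)

lemma avgs_dif: "avgs d l (dif a F) = dif a (avgs d l F)"
proof (induction l arbitrary: F)
  case (Cons j l)
  then show ?case by (simp add: avg_dif_commute)
qed simp

lemma avgs_append: "avgs d (l @ l') F = avgs d l' (avgs d l F)"
  by (induction l arbitrary: F) simp_all

lemma avgs_add: "avgs d l (\<lambda>x. F x + G x) = (\<lambda>x. avgs d l F x + avgs d l G x)"
  by (induction l arbitrary: F G) (simp_all add: avg_add)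

lemma avgs_cmult: "avgs d l (\<lambda>x. c * F x) = (\<lambda>x. c * avgs d l F x)"
  by (induction l arbitrary: F) (simp_all add: avg_cmult)

lemma norm_avgs_le: "(\<And>x. cmod (F x) \<le> M) \<Longrightarrow> cmod (avgs d l F x) \<le> M"
  by (induction l arbitrary: F) (simp_all add: norm_avg_le)

lemma walk_transform_add:
  "walk_transform \<sigma> d l (\<lambda>x. F x + G x) = (\<lambda>x. walk_transform \<sigma> d l F x + walk_transform \<sigma> d l G x)"
  by (induction l arbitrary: F G) (simp_all add: avg_add dif_add algebra_simps)

lemma walk_transform_avg: "walk_transform \<sigma> d l (avg a F) = avg a (walk_transform \<sigma> d l F)"
proof (induction l arbitrary: F)
  case (Cons j l)
  have "dif (d j) (dif (d j) (avg a F)) = avg a (dif (d j) (dif (d j) F))"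
    by (simp add: avg_dif_commute)
  moreover have "avg (d j) (avg (d j) (avg a F)) = avg a (avg (d j) (avg (d j) F))"
    by (simp add: avg_commute)
  ultimately show ?case by (simp add: Cons avg_add avg_cmult)
qed (simp add: avg_def fun_eq_iff)

lemma walk_transform_avgs: "walk_transform \<sigma> d l (avgs d l' F) = avgs d l' (walk_transform \<sigma> d l F)"
  by (induction l' arbitrary: F) (simp_all add: walk_transform_avg[symmetric])

lemma walk_transform_append:
  "walk_transform \<sigma> d (l @ l') F x = walk_transform \<sigma> d l F x + walk_transform \<sigma> d l' (avgs d l F) x"
  by (induction l arbitrary: F) simp_all

lemma walk_transform_one: "walk_transform (\<lambda>_. 1) d l F x = avgs d l F x - F x"
  by (induction l arbitrary: F) (simp_all add: avg_avg)

lemma norm_walk_transform_le: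
  assumes "\<And>j x. j \<in> set l \<Longrightarrow> cmod (dif (d j) (dif (d j) F) x) \<le> M"
    and "\<And>j. j \<in> set l \<Longrightarrow> cmod (\<sigma> j) \<le> 1"
  shows "cmod (walk_transform \<sigma> d l F x) \<le> real (length l) * M"
  using assms
proof (induction l arbitrary: F)
  case (Cons j l)
  have "cmod (\<sigma> j * dif (d j) (dif (d j) F) x) \<le> 1 * M"
    unfolding norm_mult using Cons.prems by (intro mult_mono) auto
  moreover have "cmod (walk_transform \<sigma> d l (avg (d j) (avg (d j) F)) x) \<le> real (length l) * M"
  proof (rule Cons.IH)
    fix i x assume "i \<in> set l"
    then show "cmod (dif (d i) (dif (d i) (avg (d j) (avg (d j) F))) x) \<le> M"
      using Cons.prems(1) by (simp add: avg_dif_commute[symmetric] norm_avg_le)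
  qed (use Cons.prems in auto)
  ultimately show ?case
    by (simp add: algebra_simps) (metis add.commute norm_triangle_mono)
qed simp

text \<open>The function is frozen at its initial value. Every averaging step changes it by a second
  difference, so each pair of steps contributes at most one fourth-order difference.\<close>

lemma walk_transform_expansion:
  assumes "\<And>i j x. i \<in> set l \<Longrightarrow> j \<in> set l \<Longrightarrow>
      cmod (dif (d i) (dif (d i) (dif (d j) (dif (d j) F))) x) \<le> M"
    and "\<And>j. j \<in> set l \<Longrightarrow> cmod (\<sigma> j) \<le> 1" and "M \<ge> 0"
  shows "cmod (walk_transform \<sigma> d l F x - (\<Sum>j\<leftarrow>l. \<sigma> j * dif (d j) (dif (d j) F) x)) \<le> (real (length l))\<^sup>2 * M"
  using assms
proof (induction l)
  case (Cons j l)
  have "avg (d j) (avg (d j) F) = (\<lambda>x. F x + dif (d j) (dif (d j) F) x)"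
    by (simp add: avg_avg fun_eq_iff)
  then have "walk_transform \<sigma> d (j # l) F x - (\<Sum>j\<leftarrow>j # l. \<sigma> j * dif (d j) (dif (d j) F) x)
    = (walk_transform \<sigma> d l F x - (\<Sum>j\<leftarrow>l. \<sigma> j * dif (d j) (dif (d j) F) x)) +
      walk_transform \<sigma> d l (dif (d j) (dif (d j) F)) x"
    by (simp add: walk_transform_add)
  also have "cmod \<dots> \<le> (real (length l))\<^sup>2 * M + real (length l) * M"
    using Cons.prems by (intro norm_triangle_mono Cons.IH norm_walk_transform_le) auto
  also have "\<dots> \<le> (real (length (j # l)))\<^sup>2 * M"
    using Cons.prems(3) by (simp add: power2_eq_square algebra_simps)
  finally show ?case .
qed simp

text \<open>Transforms commute with averages, so a later round produces the same discrepancy, only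
  averaged, and averaging does not increase the sup norm. Errors thus add up linearly in the number
  of rounds.\<close>

lemma walk_transform_rounds:
  assumes "\<And>x. cmod (walk_transform \<sigma> d r u x - walk_transform \<tau> d r w x) \<le> M"
  shows "cmod (walk_transform \<sigma> d (concat (replicate N r)) u x
    - walk_transform \<tau> d (concat (replicate N r)) w x) \<le> real N * M"
proof (induction N arbitrary: x)
  case (Suc N)
  let ?l = "concat (replicate N r)"
  \<comment> \<open>The difference is written with a factor -1 so that additivity and homogeneity of
    \<open>avgs\<close> apply literally.\<close>
  let ?D = "\<lambda>x. walk_transform \<sigma> d ?l u x + (-1) * walk_transform \<tau> d ?l w x"
  have "walk_transform \<sigma> d (concat (replicate (Suc N) r)) u x
      - walk_transform \<tau> d (concat (replicate (Suc N) r)) w x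
    = (walk_transform \<sigma> d r u x - walk_transform \<tau> d r w x) + avgs d r ?D x"
    unfolding avgs_add avgs_cmult
    by (simp add: walk_transform_append walk_transform_avgs)
  also have "cmod \<dots> \<le> M + real N * M"
    using Suc by (intro norm_triangle_mono assms norm_avgs_le) simp
  finally show ?case by (simp add: algebra_simps)
qed simp

section \<open>Bounded measurable functions, translations and adjoints\<close>

definition bounded_measurable :: "('a::euclidean_space \<Rightarrow> complex) \<Rightarrow> bool" where
  "bounded_measurable F \<longleftrightarrow> F \<in> borel_measurable borel \<and> (\<exists>M. \<forall>x. cmod (F x) \<le> M)"

lemma bounded_measurable_avg: "bounded_measurable F \<Longrightarrow> bounded_measurable (avg a F)"
  unfolding bounded_measurable_def
proof (elim conjE exE, intro conjI exI allI)
  fix M x assume "\<forall>x. cmod (F x) \<le> M"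
  then show "cmod (avg a F x) \<le> M" by (simp add: norm_avg_le)
qed (simp add: avg_def[abs_def])

lemma bounded_measurable_dif: "bounded_measurable F \<Longrightarrow> bounded_measurable (dif a F)"
  unfolding bounded_measurable_def
proof (elim conjE exE, intro conjI exI allI)
  fix M x assume "\<forall>x. cmod (F x) \<le> M"
  then show "cmod (dif a F x) \<le> M" by (simp add: norm_dif_le)
qed (simp add: dif_def[abs_def])

lemma bounded_measurable_add:
  assumes "bounded_measurable F" "bounded_measurable G"
  shows "bounded_measurable (\<lambda>x. F x + G x)"
proof -
  obtain M N where "\<And>x. cmod (F x) \<le> M" "\<And>x. cmod (G x) \<le> N"
    using assms by (auto simp: bounded_measurable_def)
  then have "cmod (F x + G x) \<le> M + N" for x by (intro norm_triangle_mono)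
  then show ?thesis using assms by (auto simp: bounded_measurable_def)
qed

lemma bounded_measurable_cmult:
  assumes "bounded_measurable F"
  shows "bounded_measurable (\<lambda>x. c * F x)"
proof -
  obtain M where "\<And>x. cmod (F x) \<le> M" using assms by (auto simp: bounded_measurable_def)
  then have "cmod (c * F x) \<le> cmod c * M" for x by (simp add: norm_mult mult_left_mono)
  then show ?thesis using assms by (auto simp: bounded_measurable_def)
qed

lemma bounded_measurable_walk_transform:
  "bounded_measurable F \<Longrightarrow> bounded_measurable (walk_transform \<sigma> d l F)"
proof (induction l arbitrary: F)
  case Nil
  then show ?case by (auto simp: bounded_measurable_def)
next
  case (Cons j l)
  then show ?case
    by (simp, intro bounded_measurable_add bounded_measurable_cmult bounded_measurable_dif
        Cons.IH bounded_measurable_avg Cons.prems)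
qed

lemma bounded_measurable_avgs: "bounded_measurable F \<Longrightarrow> bounded_measurable (avgs d l F)"
  by (induction l arbitrary: F) (auto intro!: bounded_measurable_avg)

lemma nn_integral_translate:
  fixes f :: "'a::euclidean_space \<Rightarrow> ennreal"
  assumes "f \<in> borel_measurable borel"
  shows "(\<integral>\<^sup>+x. f (x + a) \<partial>lborel) = (\<integral>\<^sup>+x. f x \<partial>lborel)"
proof -
  have "(\<integral>\<^sup>+x. f x \<partial>lborel) = (\<integral>\<^sup>+x. f x \<partial>distr lborel borel ((+) a))"
    by (simp add: lborel_distr_plus)
  also have "\<dots> = (\<integral>\<^sup>+x. f (a + x) \<partial>lborel)"
    using assms by (intro nn_integral_distr) auto
  finally show ?thesis by (simp add: add.commute)
qed

lemma integrable_translate: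
  fixes f :: "'a::euclidean_space \<Rightarrow> complex"
  assumes "integrable lborel f"
  shows "integrable lborel (\<lambda>x. f (x + a))"
proof -
  have "integrable (distr lborel borel ((+) a)) f" using assms by (simp add: lborel_distr_plus)
  then have "integrable lborel (\<lambda>x. f (a + x))"
    by (subst (asm) integrable_distr_eq) (use assms in auto)
  then show ?thesis by (simp add: add.commute)
qed

lemma integral_translate:
  fixes f :: "'a::euclidean_space \<Rightarrow> complex"
  assumes "f \<in> borel_measurable borel"
  shows "(\<integral>x. f (x + a) \<partial>lborel) = (\<integral>x. f x \<partial>lborel)"
proof -
  have "(\<integral>x. f x \<partial>lborel) = (\<integral>x. f x \<partial>distr lborel borel ((+) a))"
    by (simp add: lborel_distr_plus)
  also have "\<dots> = (\<integral>x. f (a + x) \<partial>lborel)"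
    using assms by (intro integral_distr) auto
  finally show ?thesis by (simp add: add.commute)
qed

lemma integrable_mult_bounded:
  assumes "integrable lborel \<Phi>" "bounded_measurable F"
  shows "integrable lborel (\<lambda>x. \<Phi> x * F x)"
proof -
  obtain M where M: "\<And>x. cmod (F x) \<le> M" using assms by (auto simp: bounded_measurable_def)
  show ?thesis
  proof (rule Bochner_Integration.integrable_bound)
    show "integrable lborel (\<lambda>x. M * cmod (\<Phi> x))" using assms by simp
    show "(\<lambda>x. \<Phi> x * F x) \<in> borel_measurable lborel"
      using assms by (auto simp: bounded_measurable_def)
    show "AE x in lborel. cmod (\<Phi> x * F x) \<le> norm (M * cmod (\<Phi> x))"
    proof (intro AE_I2)
      fix x
      have "cmod (F x) \<le> \<bar>M\<bar>" using M[of x] by linarith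
      then show "cmod (\<Phi> x * F x) \<le> norm (M * cmod (\<Phi> x))"
        by (simp add: norm_mult abs_mult mult.commute mult_right_mono)
    qed
  qed
qed

lemma integrable_avg: "integrable lborel \<Phi> \<Longrightarrow> integrable lborel (avg a \<Phi>)"
  using integrable_translate[of \<Phi> a] integrable_translate[of \<Phi> "-a"] by (simp add: avg_def[abs_def])

lemma integrable_dif: "integrable lborel \<Phi> \<Longrightarrow> integrable lborel (dif a \<Phi>)"
  using integrable_translate[of \<Phi> a] integrable_translate[of \<Phi> "-a"] by (simp add: dif_def[abs_def])

lemma integral_shift_adjoint:
  assumes \<Phi>: "integrable lborel \<Phi>" and F: "bounded_measurable F"
  shows "integrable lborel (\<lambda>x. \<Phi> x * F (x + a))"
    and "integrable lborel (\<lambda>x. \<Phi> (x - a) * F x)"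
    and "(\<integral>x. \<Phi> x * F (x + a) \<partial>lborel) = (\<integral>x. \<Phi> (x - a) * F x \<partial>lborel)"
proof -
  have [measurable]: "F \<in> borel_measurable borel" "\<Phi> \<in> borel_measurable borel"
    using assms by (auto simp: bounded_measurable_def)
  have "bounded_measurable (\<lambda>x. F (x + a))" using F by (auto simp: bounded_measurable_def)
  then show "integrable lborel (\<lambda>x. \<Phi> x * F (x + a))"
    by (rule integrable_mult_bounded[OF \<Phi>])
  show "integrable lborel (\<lambda>x. \<Phi> (x - a) * F x)"
    using integrable_mult_bounded[OF integrable_translate[OF \<Phi>, of "-a"] F] by simp
  show "(\<integral>x. \<Phi> x * F (x + a) \<partial>lborel) = (\<integral>x. \<Phi> (x - a) * F x \<partial>lborel)"
    using integral_translate[of "\<lambda>x. \<Phi> (x - a) * F x" a] by simp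
qed

lemma integral_avg_adjoint:
  assumes \<Phi>: "integrable lborel \<Phi>" and F: "bounded_measurable F"
  shows "(\<integral>x. \<Phi> x * avg a F x \<partial>lborel) = (\<integral>x. avg a \<Phi> x * F x \<partial>lborel)"
  using integral_shift_adjoint[OF assms, of a] integral_shift_adjoint[OF assms, of "-a"]
  by (simp add: avg_def algebra_simps)

lemma integral_dif_adjoint:
  assumes \<Phi>: "integrable lborel \<Phi>" and F: "bounded_measurable F"
  shows "(\<integral>x. \<Phi> x * dif a F x \<partial>lborel) = - (\<integral>x. dif a \<Phi> x * F x \<partial>lborel)"
  using integral_shift_adjoint[OF assms, of a] integral_shift_adjoint[OF assms, of "-a"]
  by (simp add: dif_def algebra_simps diff_divide_distrib)

text \<open>Induction on the walk. The adjoint relations move one average and one difference onto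
  \<Phi>, so the tail is the same claim for the averages of F and \<Phi>. Its bound, together with
  the product of the two differences, is dominated pointwise by the midpoint inequality, and the
  translates of \<open>B (F x) (\<Phi> x)\<close> have the same integral as the original. Nothing
  accumulates, so the bound depends neither on the steps nor on their number.\<close>

lemma walk_transform_bilinear_bound:
  fixes B :: "complex \<Rightarrow> complex \<Rightarrow> real" and F :: "'a::euclidean_space \<Rightarrow> complex"
  assumes B_meas: "\<And>F G :: 'a \<Rightarrow> complex. F \<in> borel_measurable borel \<Longrightarrow> G \<in> borel_measurable borel \<Longrightarrow>
      (\<lambda>x. B (F x) (G x)) \<in> borel_measurable borel"
    and B_nonneg: "\<And>u v. 0 \<le> B u v"
    and B_conv: "\<And>u v h k. B u v + cmod h * cmod k \<le> (B (u + h) (v + k) + B (u - h) (v - k)) / 2"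
    and \<sigma>: "\<And>j. j \<in> set l \<Longrightarrow> cmod (\<sigma> j) \<le> 1"
    and F: "bounded_measurable F" and \<Phi>: "integrable lborel \<Phi>"
  shows "ennreal (cmod (\<integral>x. \<Phi> x * walk_transform \<sigma> d l F x \<partial>lborel)) \<le> (\<integral>\<^sup>+x. B (F x) (\<Phi> x) \<partial>lborel)"
  using F \<Phi> \<sigma>
proof (induction l arbitrary: F \<Phi>)
  case (Cons j l)
  let ?a = "d j" and ?I = "\<lambda>f :: 'a \<Rightarrow> complex. integral\<^sup>L lborel f"
  have [measurable]: "F \<in> borel_measurable borel" "\<Phi> \<in> borel_measurable borel"
    using Cons.prems by (auto simp: bounded_measurable_def)
  note bm = bounded_measurable_dif bounded_measurable_avg bounded_measurable_walk_transform
    Cons.prems(1)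
  have "?I (\<lambda>x. \<Phi> x * walk_transform \<sigma> d (j # l) F x) =
      ?I (\<lambda>x. \<sigma> j * (\<Phi> x * dif ?a (dif ?a F) x) + \<Phi> x * avg ?a (walk_transform \<sigma> d l (avg ?a F)) x)"
    by (simp add: walk_transform_avg algebra_simps)
  also have "\<dots> = \<sigma> j * ?I (\<lambda>x. \<Phi> x * dif ?a (dif ?a F) x) +
      ?I (\<lambda>x. \<Phi> x * avg ?a (walk_transform \<sigma> d l (avg ?a F)) x)"
    by (subst Bochner_Integration.integral_add)
       (auto intro!: integrable_mult_right integrable_mult_bounded Cons.prems bm)
  also have "\<dots> = - \<sigma> j * ?I (\<lambda>x. dif ?a \<Phi> x * dif ?a F x) +
      ?I (\<lambda>x. avg ?a \<Phi> x * walk_transform \<sigma> d l (avg ?a F) x)"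
    using integral_dif_adjoint[OF Cons.prems(2) bm(1)[OF Cons.prems(1)], of ?a ?a]
      integral_avg_adjoint[OF Cons.prems(2) bm(3)[OF bm(2)[OF Cons.prems(1)]], of ?a] by simp
  finally have eq: "?I (\<lambda>x. \<Phi> x * walk_transform \<sigma> d (j # l) F x) = - \<sigma> j * ?I (\<lambda>x. dif ?a \<Phi> x * dif ?a F x) +
      ?I (\<lambda>x. avg ?a \<Phi> x * walk_transform \<sigma> d l (avg ?a F) x)" .
  have "cmod (?I (\<lambda>x. \<Phi> x * walk_transform \<sigma> d (j # l) F x))
      \<le> cmod (\<sigma> j) * cmod (?I (\<lambda>x. dif ?a \<Phi> x * dif ?a F x)) +
        cmod (?I (\<lambda>x. avg ?a \<Phi> x * walk_transform \<sigma> d l (avg ?a F) x))"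
    unfolding eq by (rule order_trans[OF norm_triangle_ineq]) (simp add: norm_mult)
  also have "\<dots> \<le> 1 * cmod (?I (\<lambda>x. dif ?a \<Phi> x * dif ?a F x)) +
        cmod (?I (\<lambda>x. avg ?a \<Phi> x * walk_transform \<sigma> d l (avg ?a F) x))"
    using Cons.prems(3) by (intro add_right_mono mult_right_mono) auto
  finally have "ennreal (cmod (?I (\<lambda>x. \<Phi> x * walk_transform \<sigma> d (j # l) F x)))
      \<le> ennreal (cmod (?I (\<lambda>x. dif ?a \<Phi> x * dif ?a F x))) +
        ennreal (cmod (?I (\<lambda>x. avg ?a \<Phi> x * walk_transform \<sigma> d l (avg ?a F) x)))"
    by (simp add: ennreal_plus[symmetric] del: ennreal_plus)
  also have "\<dots> \<le> (\<integral>\<^sup>+x. ennreal (cmod (dif ?a \<Phi> x * dif ?a F x)) \<partial>lborel) +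
      (\<integral>\<^sup>+x. ennreal (B (avg ?a F x) (avg ?a \<Phi> x)) \<partial>lborel)"
    using Cons.prems
    by (intro add_mono integral_norm_bound_ennreal integrable_mult_bounded integrable_dif Cons.IH
        integrable_avg bm) auto
  also have "\<dots> = (\<integral>\<^sup>+x. ennreal (cmod (dif ?a \<Phi> x * dif ?a F x)) + ennreal (B (avg ?a F x) (avg ?a \<Phi> x)) \<partial>lborel)"
    unfolding avg_def dif_def
    by (intro nn_integral_add[symmetric]) (auto intro!: measurable_compose[OF B_meas measurable_ennreal])
  also have "\<dots> \<le> (\<integral>\<^sup>+x. ennreal (1/2) * (ennreal (B (F (x + ?a)) (\<Phi> (x + ?a))) + ennreal (B (F (x + - ?a)) (\<Phi> (x + - ?a)))) \<partial>lborel)"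
  proof (intro nn_integral_mono)
    fix x
    \<comment> \<open>Average plus and minus difference recover the two translates; the midpoint
      inequality is applied with the averages as base point and the differences as
      increments.\<close>
    have "avg ?a G x + dif ?a G x = G (x + ?a)" "avg ?a G x - dif ?a G x = G (x + - ?a)" for G :: "'a \<Rightarrow> complex"
      by (simp_all add: avg_def dif_def field_simps)
    then have "cmod (dif ?a \<Phi> x * dif ?a F x) + B (avg ?a F x) (avg ?a \<Phi> x) \<le>
        1/2 * (B (F (x + ?a)) (\<Phi> (x + ?a)) + B (F (x + - ?a)) (\<Phi> (x + - ?a)))"
      using B_conv[of "avg ?a F x" "avg ?a \<Phi> x" "dif ?a F x" "dif ?a \<Phi> x"]
      by (simp add: norm_mult mult.commute)
    then have "ennreal (cmod (dif ?a \<Phi> x * dif ?a F x) + B (avg ?a F x) (avg ?a \<Phi> x)) \<le>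
        ennreal (1/2 * (B (F (x + ?a)) (\<Phi> (x + ?a)) + B (F (x + - ?a)) (\<Phi> (x + - ?a))))"
      by (rule ennreal_leI)
    also have "\<dots> = ennreal (1/2) * (ennreal (B (F (x + ?a)) (\<Phi> (x + ?a))) + ennreal (B (F (x + - ?a)) (\<Phi> (x + - ?a))))"
      by (simp only: ennreal_mult' ennreal_plus B_nonneg zero_le_divide_1_iff zero_le_numeral)
    finally show "ennreal (cmod (dif ?a \<Phi> x * dif ?a F x)) + ennreal (B (avg ?a F x) (avg ?a \<Phi> x))
      \<le> ennreal (1/2) * (ennreal (B (F (x + ?a)) (\<Phi> (x + ?a))) + ennreal (B (F (x + - ?a)) (\<Phi> (x + - ?a))))"
      by (simp only: ennreal_plus B_nonneg norm_ge_zero)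
  qed
  also have "\<dots> = ennreal (1/2) * ((\<integral>\<^sup>+x. ennreal (B (F (x + ?a)) (\<Phi> (x + ?a))) \<partial>lborel) +
      (\<integral>\<^sup>+x. ennreal (B (F (x + - ?a)) (\<Phi> (x + - ?a))) \<partial>lborel))"
  proof -
    have [measurable]: "(\<lambda>x. ennreal (B (F (x + b)) (\<Phi> (x + b)))) \<in> borel_measurable lborel" for b
      by (auto intro!: measurable_compose[OF B_meas measurable_ennreal])
    show ?thesis
      by (subst nn_integral_cmult; (subst nn_integral_add)?; (intro refl)?) measurable
  qed
  also have "\<dots> = ennreal (1/2) * ((\<integral>\<^sup>+x. ennreal (B (F x) (\<Phi> x)) \<partial>lborel) +
      (\<integral>\<^sup>+x. ennreal (B (F x) (\<Phi> x)) \<partial>lborel))"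
    by (subst (1 2) nn_integral_translate[of "\<lambda>x. ennreal (B (F x) (\<Phi> x))"])
       (auto intro!: measurable_compose[OF B_meas measurable_ennreal])
  also have "\<dots> = (\<integral>\<^sup>+x. ennreal (B (F x) (\<Phi> x)) \<partial>lborel)"
  proof -
    have "ennreal (1/2) * (I + I) = I" for I :: ennreal
    proof -
      have "ennreal (1/2) * (I + I) = (ennreal (1/2) * ennreal 2) * I"
        by (simp add: mult_2[symmetric] mult.assoc del: ennreal_numeral) (simp add: mult_2)
      also have "ennreal (1/2) * ennreal 2 = 1"
        by (subst ennreal_mult[symmetric]) auto
      finally show ?thesis by simp
    qed
    then show ?thesis .
  qed
  finally show ?case .
qed simp

section \<open>\<open>L\<^sup>2\<close> energy along the walk\<close>

definition energy :: "('a::euclidean_space \<Rightarrow> complex) \<Rightarrow> ennreal" where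
  "energy F = (\<integral>\<^sup>+x. ennreal ((cmod (F x))\<^sup>2) \<partial>lborel)"

text \<open>The parallelogram law for the values at x + a and x - a, integrated with translation
  invariance: an average loses exactly the energy of the difference.\<close>

lemma energy_avg_dif:
  assumes [measurable]: "F \<in> borel_measurable borel"
  shows "energy (avg a F) + energy (dif a F) = energy F"
proof -
  have "energy (avg a F) + energy (dif a F) =
      (\<integral>\<^sup>+x. ennreal ((cmod (avg a F x))\<^sup>2) + ennreal ((cmod (dif a F x))\<^sup>2) \<partial>lborel)"
    unfolding energy_def avg_def dif_def by (intro nn_integral_add[symmetric]) auto
  also have "\<dots> = (\<integral>\<^sup>+x. ennreal ((cmod (F (x + a)))\<^sup>2 / 2) + ennreal ((cmod (F (x + - a)))\<^sup>2 / 2) \<partial>lborel)"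
  proof (intro nn_integral_cong)
    fix x
    have "(cmod (avg a F x))\<^sup>2 + (cmod (dif a F x))\<^sup>2 = (cmod (F (x + a)))\<^sup>2 / 2 + (cmod (F (x + - a)))\<^sup>2 / 2"
      unfolding avg_def dif_def cmod_power2 by (simp add: power2_eq_square field_simps)
    then show "ennreal ((cmod (avg a F x))\<^sup>2) + ennreal ((cmod (dif a F x))\<^sup>2) =
        ennreal ((cmod (F (x + a)))\<^sup>2 / 2) + ennreal ((cmod (F (x + - a)))\<^sup>2 / 2)"
      by (simp add: ennreal_plus[symmetric] del: ennreal_plus)
  qed
  also have "\<dots> = (\<integral>\<^sup>+x. ennreal ((cmod (F (x + a)))\<^sup>2 / 2) \<partial>lborel) + (\<integral>\<^sup>+x. ennreal ((cmod (F (x + - a)))\<^sup>2 / 2) \<partial>lborel)"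
    by (intro nn_integral_add) auto
  also have "\<dots> = (\<integral>\<^sup>+x. ennreal ((cmod (F x))\<^sup>2 / 2) \<partial>lborel) + (\<integral>\<^sup>+x. ennreal ((cmod (F x))\<^sup>2 / 2) \<partial>lborel)"
    by (subst (1 2) nn_integral_translate[of "\<lambda>x. ennreal ((cmod (F x))\<^sup>2 / 2)"]) auto
  also have "\<dots> = energy F"
    unfolding energy_def
    by (subst nn_integral_add[symmetric]) (auto simp: ennreal_plus[symmetric] simp del: ennreal_plus)
  finally show ?thesis .
qed

lemma energy_avg_le: "F \<in> borel_measurable borel \<Longrightarrow> energy (avg a F) \<le> energy F"
  using energy_avg_dif[of F a] by (metis le_iff_add)

lemma measurable_avg [measurable (raw)]: "F \<in> borel_measurable borel \<Longrightarrow> avg a F \<in> borel_measurable borel"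
  for a :: "'a::euclidean_space"
  by (simp add: avg_def[abs_def])

lemma measurable_dif [measurable (raw)]: "F \<in> borel_measurable borel \<Longrightarrow> dif a F \<in> borel_measurable borel"
  for a :: "'a::euclidean_space"
  by (simp add: dif_def[abs_def])

lemma measurable_avgs: "F \<in> borel_measurable borel \<Longrightarrow> avgs d l F \<in> borel_measurable borel"
  for d :: "'i \<Rightarrow> 'a::euclidean_space"
  by (induction l arbitrary: F) (simp_all add: measurable_avg)

lemma energy_avgs_le: "F \<in> borel_measurable borel \<Longrightarrow> energy (avgs d l F) \<le> energy F"
proof (induction l arbitrary: F)
  case (Cons j l)
  have "energy (avgs d l (avg (d j) (avg (d j) F))) \<le> energy (avg (d j) (avg (d j) F))"
    using Cons by (simp add: measurable_avg)
  also have "\<dots> \<le> energy (avg (d j) F)" using Cons by (simp add: measurable_avg energy_avg_le)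
  also have "\<dots> \<le> energy F" using Cons by (simp add: energy_avg_le)
  finally show ?case by simp
qed simp

text \<open>Averages commute, so the double average along \<open>d j\<close> may be performed first.
  Its first half already loses the energy of \<open>dif (d j) F\<close>, and the averages along the
  walk only shrink that difference.\<close>

lemma energy_avgs_dif_le:
  assumes "j \<in> set l" "F \<in> borel_measurable borel"
  shows "energy (avgs d l F) + energy (dif (d j) (avgs d l F)) \<le> energy F"
proof -
  have m: "avg a (avg b F) \<in> borel_measurable borel" "avg a F \<in> borel_measurable borel"
    "dif a F \<in> borel_measurable borel" for a b
    using assms(2) by (simp_all add: measurable_avg measurable_dif)
  from assms(1) obtain l1 l2 where l: "l = l1 @ j # l2" by (meson split_list)
  have eq: "avgs d l F = avgs d (l1 @ l2) (avg (d j) (avg (d j) F))"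
    by (simp add: l avgs_append avgs_avg)
  have "energy (avgs d l F) \<le> energy (avg (d j) (avg (d j) F))"
    unfolding eq by (intro energy_avgs_le m)
  also have "\<dots> \<le> energy (avg (d j) F)" by (intro energy_avg_le m)
  finally have 1: "energy (avgs d l F) \<le> energy (avg (d j) F)" .
  have "energy (dif (d j) (avgs d l F)) = energy (avgs d (l1 @ l2) (avg (d j) (avg (d j) (dif (d j) F))))"
    unfolding eq by (simp add: avgs_dif[symmetric] avg_dif_commute)
  also have "\<dots> \<le> energy (avg (d j) (avg (d j) (dif (d j) F)))"
    by (intro energy_avgs_le measurable_avg m)
  also have "\<dots> \<le> energy (avg (d j) (dif (d j) F))" by (intro energy_avg_le measurable_avg m)
  also have "\<dots> \<le> energy (dif (d j) F)" by (intro energy_avg_le m)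
  finally have "energy (dif (d j) (avgs d l F)) \<le> energy (dif (d j) F)" .
  with 1 show ?thesis
    using energy_avg_dif[OF assms(2), of "d j"] by (metis add_mono)
qed

text \<open>Every round loses at least the energy of the difference that is left at the end, and the
  total loss is at most the initial energy. The first summand carries the induction.\<close>

lemma energy_rounds_dif_le:
  assumes j: "j \<in> set r" and "F \<in> borel_measurable borel"
  shows "energy (avgs d (concat (replicate N r)) F) +
    of_nat N * energy (dif (d j) (avgs d (concat (replicate N r)) F)) \<le> energy F"
  using assms(2)
proof (induction N arbitrary: F)
  case (Suc N)
  let ?l = "concat (replicate N r)" and ?F = "avgs d r F"
  have m: "?F \<in> borel_measurable borel" using Suc.prems by (rule measurable_avgs)
  have "energy (dif (d j) (avgs d ?l ?F)) \<le> energy (dif (d j) ?F)"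
    unfolding avgs_dif[symmetric] by (intro energy_avgs_le measurable_avgs measurable_dif Suc.prems)
  then have "(energy (avgs d ?l ?F) + of_nat N * energy (dif (d j) (avgs d ?l ?F))) +
      energy (dif (d j) (avgs d ?l ?F)) \<le> energy ?F + energy (dif (d j) ?F)"
    by (intro add_mono Suc.IH m)
  also have "\<dots> \<le> energy F" by (rule energy_avgs_dif_le[OF j Suc.prems])
  finally show ?case by (simp add: avgs_append algebra_simps)
qed simp

section \<open>Schwartz functions\<close>

lemma partial_derivative_eq:
  assumes "(f has_derivative f') (at y)"
  shows "partial_derivative k f y = f' (axis k 1)"
proof -
  have "((\<lambda>t. f (y + t *\<^sub>R axis k 1)) has_derivative (\<lambda>t. f' (0 + t *\<^sub>R axis k 1))) (at 0)"
    using assms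
    by (intro has_derivative_compose[of "\<lambda>t. y + t *\<^sub>R axis k 1" _ 0 UNIV f f', unfolded o_def])
       (auto intro!: derivative_eq_intros)
  moreover have "(\<lambda>t. f' (0 + t *\<^sub>R axis k 1)) = (\<lambda>t. t *\<^sub>R f' (axis k 1))"
    using has_derivative_linear[OF assms] by (simp add: linear_cmul fun_eq_iff)
  ultimately show ?thesis
    unfolding partial_derivative_def
    by (intro vector_derivative_at) (simp add: has_vector_derivative_def)
qed

text \<open>Expressed through coordinate partial derivatives, so that it stays in the Schwartz class
  by closure under sums and scalar multiples; at points of differentiability it is the Frechet
  derivative in direction v.\<close>

definition dir_deriv :: "real^'n \<Rightarrow> (real^'n::finite \<Rightarrow> complex) \<Rightarrow> real^'n \<Rightarrow> complex" where
  "dir_deriv v f y = (\<Sum>k\<in>UNIV. complex_of_real (v $ k) * partial_derivative k f y)"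

lemma has_derivative_dir_deriv:
  assumes "f differentiable (at y)"
  shows "(f has_derivative (\<lambda>v. dir_deriv v f y)) (at y)"
proof -
  obtain f' where f': "(f has_derivative f') (at y)" using assms by (auto simp: differentiable_def)
  have "f' v = dir_deriv v f y" for v
  proof -
    have "f' v = f' (\<Sum>k\<in>UNIV. (v $ k) *\<^sub>R axis k 1)"
      using basis_expansion[of v] by (simp add: scalar_mult_eq_scaleR)
    also have "\<dots> = (\<Sum>k\<in>UNIV. (v $ k) *\<^sub>R f' (axis k 1))"
      using has_derivative_linear[OF f'] by (simp add: linear_sum linear_cmul)
    finally show ?thesis
      by (simp add: dir_deriv_def partial_derivative_eq[OF f'] scaleR_conv_of_real)
  qed
  then have "f' = (\<lambda>v. dir_deriv v f y)" by (rule ext)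
  with f' show ?thesis by simp
qed

text \<open>Coinduction in place of Leibniz formulas for iterated derivatives: a class closed under
  a single partial derivative, with differentiable members that are bounded against all monomials,
  consists of Schwartz functions.\<close>

lemma schwartz_coinduct:
  fixes f :: "real^'n::finite \<Rightarrow> complex"
  assumes "P f"
    and "\<And>f y. P f \<Longrightarrow> f differentiable (at y)"
    and "\<And>f (\<beta> :: 'n \<Rightarrow> nat). P f \<Longrightarrow> \<exists>B. \<forall>y. norm ((\<Prod>j\<in>UNIV. (y $ j) ^ \<beta> j) *\<^sub>R f y) \<le> B"
    and "\<And>f k. P f \<Longrightarrow> P (partial_derivative k f)"
  shows "f \<in> schwartz"
proof -
  have "P (iterated_partial ks f)" for ks
    by (induction ks) (use assms in \<open>auto simp: iterated_partial_def\<close>)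
  then show ?thesis using assms unfolding schwartz_def by blast
qed

lemma schwartz_differentiable: "f \<in> schwartz \<Longrightarrow> f differentiable (at y)"
  unfolding schwartz_def by (auto simp: iterated_partial_def dest: spec[of _ "[]"])

lemma schwartz_monomial_bound:
  fixes f :: "real^'n::finite \<Rightarrow> complex"
  assumes "f \<in> schwartz"
  shows "\<exists>B. \<forall>y. norm ((\<Prod>j\<in>UNIV. (y $ j) ^ \<beta> j) *\<^sub>R f y) \<le> B"
  using assms unfolding schwartz_def by (auto simp: iterated_partial_def dest: spec[of _ "[]"])

lemma schwartz_bounded:
  assumes "f \<in> schwartz"
  obtains B where "B \<ge> 0" "\<And>y. cmod (f y) \<le> B"
proof -
  obtain B where B: "\<And>y. cmod (f y) \<le> B"
    using schwartz_monomial_bound[OF assms, of "\<lambda>_. 0"] by auto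
  moreover have "B \<ge> 0" using B norm_ge_zero order_trans by blast
  ultimately show ?thesis using that by blast
qed

lemma schwartz_partial_derivative:
  assumes "f \<in> schwartz"
  shows "partial_derivative k f \<in> schwartz"
proof -
  have "iterated_partial ks (partial_derivative k f) = iterated_partial (ks @ [k]) f" for ks
    by (simp add: iterated_partial_def)
  with assms show ?thesis by (simp add: schwartz_def)
qed

lemma partial_derivative_add:
  assumes "f \<in> schwartz" "g \<in> schwartz"
  shows "partial_derivative k (\<lambda>y. f y + g y) = (\<lambda>y. partial_derivative k f y + partial_derivative k g y)"
proof
  fix y
  have d: "(f has_derivative (\<lambda>v. dir_deriv v f y)) (at y)" "(g has_derivative (\<lambda>v. dir_deriv v g y)) (at y)"
    using assms by (auto intro!: has_derivative_dir_deriv schwartz_differentiable)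
  show "partial_derivative k (\<lambda>y. f y + g y) y = partial_derivative k f y + partial_derivative k g y"
    unfolding partial_derivative_eq[OF has_derivative_add[OF d]] by (simp add: d[THEN partial_derivative_eq])
qed

lemma schwartz_add:
  assumes "f \<in> schwartz" "g \<in> schwartz"
  shows "(\<lambda>y. f y + g y) \<in> schwartz"
proof (rule schwartz_coinduct[where P = "\<lambda>h. \<exists>f\<in>schwartz. \<exists>g\<in>schwartz. h = (\<lambda>y. f y + g y)"])
  fix h :: "real^'n \<Rightarrow> complex" and \<beta> :: "'n \<Rightarrow> nat"
  assume "\<exists>f\<in>schwartz. \<exists>g\<in>schwartz. h = (\<lambda>y. f y + g y)"
  then obtain f g where fg: "f \<in> schwartz" "g \<in> schwartz" "h = (\<lambda>y. f y + g y)" by auto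
  obtain B C where "\<And>y. norm ((\<Prod>j\<in>UNIV. (y $ j) ^ \<beta> j) *\<^sub>R f y) \<le> B"
    "\<And>y. norm ((\<Prod>j\<in>UNIV. (y $ j) ^ \<beta> j) *\<^sub>R g y) \<le> C"
    using schwartz_monomial_bound[OF fg(1), of \<beta>] schwartz_monomial_bound[OF fg(2), of \<beta>] by auto
  then have "norm ((\<Prod>j\<in>UNIV. (y $ j) ^ \<beta> j) *\<^sub>R h y) \<le> B + C" for y
    unfolding fg scaleR_add_right by (intro norm_triangle_mono)
  then show "\<exists>B. \<forall>y. norm ((\<Prod>j\<in>UNIV. (y $ j) ^ \<beta> j) *\<^sub>R h y) \<le> B" by blast
next
  fix h :: "real^'n \<Rightarrow> complex" and k :: 'n
  assume "\<exists>f\<in>schwartz. \<exists>g\<in>schwartz. h = (\<lambda>y. f y + g y)"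
  then show "\<exists>f\<in>schwartz. \<exists>g\<in>schwartz. partial_derivative k h = (\<lambda>y. f y + g y)"
    using partial_derivative_add schwartz_partial_derivative by blast
next
  fix h :: "real^'n \<Rightarrow> complex" and y
  assume "\<exists>f\<in>schwartz. \<exists>g\<in>schwartz. h = (\<lambda>y. f y + g y)"
  then show "h differentiable (at y)"
    using schwartz_differentiable by (auto intro!: differentiable_add)
qed (use assms in auto)

lemma partial_derivative_cmult:
  assumes "f \<in> schwartz"
  shows "partial_derivative k (\<lambda>y. c * f y) = (\<lambda>y. c * partial_derivative k f y)"
proof
  fix y
  have d: "(f has_derivative (\<lambda>v. dir_deriv v f y)) (at y)"
    using assms by (auto intro!: has_derivative_dir_deriv schwartz_differentiable)
  have "((\<lambda>y. c * f y) has_derivative (\<lambda>v. c * dir_deriv v f y)) (at y)"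
    using d by (auto intro!: derivative_eq_intros)
  from partial_derivative_eq[OF this, of k]
  show "partial_derivative k (\<lambda>y. c * f y) y = c * partial_derivative k f y"
    by (simp add: d[THEN partial_derivative_eq])
qed

lemma schwartz_cmult:
  assumes "f \<in> schwartz"
  shows "(\<lambda>y. c * f y) \<in> schwartz"
proof (rule schwartz_coinduct[where P = "\<lambda>h. \<exists>f\<in>schwartz. h = (\<lambda>y. c * f y)"])
  fix h :: "real^'n \<Rightarrow> complex" and \<beta> :: "'n \<Rightarrow> nat"
  assume "\<exists>f\<in>schwartz. h = (\<lambda>y. c * f y)"
  then obtain f where f: "f \<in> schwartz" "h = (\<lambda>y. c * f y)" by auto
  obtain B where B: "\<And>y. norm ((\<Prod>j\<in>UNIV. (y $ j) ^ \<beta> j) *\<^sub>R f y) \<le> B"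
    using schwartz_monomial_bound[OF f(1), of \<beta>] by auto
  have "norm ((\<Prod>j\<in>UNIV. (y $ j) ^ \<beta> j) *\<^sub>R h y) \<le> cmod c * B" for y
    using mult_left_mono[OF B[of y], of "cmod c"] by (simp add: f norm_mult mult_ac)
  then show "\<exists>B. \<forall>y. norm ((\<Prod>j\<in>UNIV. (y $ j) ^ \<beta> j) *\<^sub>R h y) \<le> B" by blast
next
  fix h :: "real^'n \<Rightarrow> complex" and k :: 'n
  assume "\<exists>f\<in>schwartz. h = (\<lambda>y. c * f y)"
  then show "\<exists>f\<in>schwartz. partial_derivative k h = (\<lambda>y. c * f y)"
    using partial_derivative_cmult schwartz_partial_derivative by blast
next
  fix h :: "real^'n \<Rightarrow> complex" and y
  assume "\<exists>f\<in>schwartz. h = (\<lambda>y. c * f y)"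
  then show "h differentiable (at y)"
    using schwartz_differentiable by (auto intro!: differentiable_mult)
qed (use assms in auto)

lemma schwartz_sum:
  assumes "finite K" "K \<noteq> {}" "\<And>k. k \<in> K \<Longrightarrow> f k \<in> schwartz"
  shows "(\<lambda>y. \<Sum>k\<in>K. f k y) \<in> schwartz"
  using assms
proof (induction K rule: finite_ne_induct)
  case (insert k K)
  then show ?case by (simp add: schwartz_add)
qed simp

lemma schwartz_dir_deriv: "f \<in> schwartz \<Longrightarrow> dir_deriv v f \<in> schwartz"
  unfolding dir_deriv_def[abs_def]
  by (intro schwartz_sum schwartz_cmult schwartz_partial_derivative) auto

lemma has_derivative_coordinate_mult:
  assumes "f \<in> schwartz"
  shows "((\<lambda>y. complex_of_real (y $ j) * f y) has_derivative
    (\<lambda>v. complex_of_real (v $ j) * f y + complex_of_real (y $ j) * dir_deriv v f y)) (at y)"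
proof -
  have "(f has_derivative (\<lambda>v. dir_deriv v f y)) (at y)"
    using assms by (auto intro!: has_derivative_dir_deriv schwartz_differentiable)
  moreover have "((\<lambda>y. complex_of_real (y $ j)) has_derivative (\<lambda>v. complex_of_real (v $ j))) (at y)"
    by (intro bounded_linear.has_derivative[OF bounded_linear_of_real]
        bounded_linear.has_derivative[OF bounded_linear_vec_nth] has_derivative_ident)
  ultimately show ?thesis
    by (intro has_derivative_eq_rhs[OF has_derivative_mult]) (auto simp: add.commute)
qed

lemma dir_deriv_axis: "dir_deriv (axis k 1) f = partial_derivative k f"
proof
  fix y
  have "dir_deriv (axis k 1) f y = (\<Sum>i\<in>UNIV. if i = k then partial_derivative i f y else 0)"
    unfolding dir_deriv_def by (intro sum.cong) (auto simp: axis_def)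
  then show "dir_deriv (axis k 1) f y = partial_derivative k f y" by simp
qed

text \<open>Differentiating y_j f produces a multiple of f besides y_j times a derivative, so the
  invariant class consists of all y_j f + g.\<close>

lemma schwartz_coordinate_mult:
  fixes f :: "real^'n::finite \<Rightarrow> complex"
  assumes f: "f \<in> schwartz"
  shows "(\<lambda>y. complex_of_real (y $ j) * f y) \<in> schwartz"
proof (rule schwartz_coinduct[where P = "\<lambda>h. \<exists>f\<in>schwartz. \<exists>g\<in>schwartz. h = (\<lambda>y. complex_of_real (y $ j) * f y + g y)"])
  have "(\<lambda>y. 0 * f y) \<in> schwartz" using f by (rule schwartz_cmult)
  then show "\<exists>fa\<in>schwartz. \<exists>g\<in>schwartz. (\<lambda>y. complex_of_real (y $ j) * f y) = (\<lambda>y. complex_of_real (y $ j) * fa y + g y)"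
    using f by (intro bexI[of _ f] bexI[of _ "\<lambda>y. 0 * f y"]) auto
next
  fix h :: "real^'n \<Rightarrow> complex" and \<beta> :: "'n \<Rightarrow> nat"
  assume "\<exists>f\<in>schwartz. \<exists>g\<in>schwartz. h = (\<lambda>y. complex_of_real (y $ j) * f y + g y)"
  then obtain f g where fg: "f \<in> schwartz" "g \<in> schwartz" "h = (\<lambda>y. complex_of_real (y $ j) * f y + g y)" by auto
  \<comment> \<open>Raising the exponent of y_j by one absorbs the factor y_j into the monomial
    bound for f.\<close>
  define \<gamma> where "\<gamma> = \<beta>(j := Suc (\<beta> j))"
  have \<gamma>: "(\<Prod>i\<in>UNIV. (y $ i) ^ \<gamma> i) = (\<Prod>i\<in>UNIV. (y $ i) ^ \<beta> i) * y $ j" for y :: "real^'n"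
  proof -
    have "(\<Prod>i\<in>UNIV. (y $ i) ^ \<gamma> i) = (y $ j) ^ \<gamma> j * (\<Prod>i\<in>UNIV - {j}. (y $ i) ^ \<gamma> i)"
      by (rule prod.remove) auto
    also have "(\<Prod>i\<in>UNIV - {j}. (y $ i) ^ \<gamma> i) = (\<Prod>i\<in>UNIV - {j}. (y $ i) ^ \<beta> i)"
      by (intro prod.cong) (auto simp: \<gamma>_def)
    also have "(y $ j) ^ \<gamma> j * (\<Prod>i\<in>UNIV - {j}. (y $ i) ^ \<beta> i) =
        y $ j * ((y $ j) ^ \<beta> j * (\<Prod>i\<in>UNIV - {j}. (y $ i) ^ \<beta> i))"
      by (simp add: \<gamma>_def)
    also have "(y $ j) ^ \<beta> j * (\<Prod>i\<in>UNIV - {j}. (y $ i) ^ \<beta> i) = (\<Prod>i\<in>UNIV. (y $ i) ^ \<beta> i)"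
      by (rule prod.remove[symmetric]) auto
    finally show ?thesis by simp
  qed
  obtain B C where B: "\<And>y. norm ((\<Prod>j\<in>UNIV. (y $ j) ^ \<gamma> j) *\<^sub>R f y) \<le> B"
    and C: "\<And>y. norm ((\<Prod>j\<in>UNIV. (y $ j) ^ \<beta> j) *\<^sub>R g y) \<le> C"
    using schwartz_monomial_bound[OF fg(1), of \<gamma>] schwartz_monomial_bound[OF fg(2), of \<beta>] by auto
  have "norm ((\<Prod>j\<in>UNIV. (y $ j) ^ \<beta> j) *\<^sub>R h y) \<le> B + C" for y
    unfolding fg scaleR_add_right using B[of y] C[of y]
    by (intro norm_triangle_mono) (simp_all add: \<gamma> norm_mult abs_mult mult_ac)
  then show "\<exists>B. \<forall>y. norm ((\<Prod>j\<in>UNIV. (y $ j) ^ \<beta> j) *\<^sub>R h y) \<le> B" by blast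
next
  fix h :: "real^'n \<Rightarrow> complex"
  assume "\<exists>f\<in>schwartz. \<exists>g\<in>schwartz. h = (\<lambda>y. complex_of_real (y $ j) * f y + g y)"
  then obtain f g where fg: "f \<in> schwartz" "g \<in> schwartz" "h = (\<lambda>y. complex_of_real (y $ j) * f y + g y)" by auto
  have d: "(h has_derivative (\<lambda>v. (complex_of_real (v $ j) * f y + complex_of_real (y $ j) * dir_deriv v f y)
       + dir_deriv v g y)) (at y)" for y
    unfolding fg
    by (intro has_derivative_add has_derivative_coordinate_mult has_derivative_dir_deriv
        schwartz_differentiable fg)
  show "h differentiable (at y)" for y using d by (auto simp: differentiable_def)
  show "\<exists>f\<in>schwartz. \<exists>g\<in>schwartz. partial_derivative k h = (\<lambda>y. complex_of_real (y $ j) * f y + g y)" for k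
  proof (intro bexI)
    show "partial_derivative k h = (\<lambda>y. complex_of_real (y $ j) * partial_derivative k f y +
        (complex_of_real (axis k 1 $ j) * f y + partial_derivative k g y))"
      by (auto simp: partial_derivative_eq[OF d] dir_deriv_axis)
  qed (intro schwartz_add schwartz_cmult schwartz_partial_derivative fg)+
qed

section \<open>The chirp as a multiplier of the Schwartz class\<close>

lemma has_derivative_chirp:
  "(chirp \<alpha> has_derivative (\<lambda>v. chirp \<alpha> y * (\<i> * (\<Sum>k\<in>UNIV. complex_of_real (v $ k) *
     (complex_of_real (cot (\<alpha> $ k)) * complex_of_real (y $ k)))))) (at y)"
proof -
  have c: "((\<lambda>y::real^2. complex_of_real (y $ j)) has_derivative (\<lambda>v. complex_of_real (v $ j))) (at y)" for j
    by (intro bounded_linear.has_derivative[OF bounded_linear_of_real]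
        bounded_linear.has_derivative[OF bounded_linear_vec_nth] has_derivative_ident)
  have sq: "((\<lambda>y. (complex_of_real (y $ j))\<^sup>2 * w) has_derivative
      (\<lambda>v. 2 * complex_of_real (v $ j) * complex_of_real (y $ j) * w)) (at y)" for j w
    by (rule has_derivative_eq_rhs[OF has_derivative_mult_left[OF has_derivative_power[OF c]]]) simp
  have "((\<lambda>y. \<i> / 2 * ((complex_of_real (y $ 1))\<^sup>2 * complex_of_real (cot (\<alpha> $ 1)) +
      (complex_of_real (y $ 2))\<^sup>2 * complex_of_real (cot (\<alpha> $ 2)))) has_derivative
      (\<lambda>v. \<i> * (\<Sum>k\<in>UNIV. complex_of_real (v $ k) *
     (complex_of_real (cot (\<alpha> $ k)) * complex_of_real (y $ k))))) (at y)"
    by (rule has_derivative_eq_rhs[OF has_derivative_mult_right[OF has_derivative_add[OF sq sq]]])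
      (simp add: sum_2 algebra_simps add_divide_distrib fun_eq_iff)
  from has_derivative_compose[OF this DERIV_exp[unfolded has_field_derivative_def]]
  show ?thesis
    unfolding chirp_def[abs_def] of_real_add of_real_mult of_real_power .
qed

lemma norm_chirp: "cmod (chirp \<alpha> y) = 1"
  by (simp add: chirp_def)

text \<open>The logarithmic derivative of the chirp in direction k is the linear function i
  cot(\<alpha>_k) y_k, so products of the chirp with Schwartz functions are closed under
  differentiation; modulus 1 preserves the monomial bounds.\<close>

lemma schwartz_chirp_mult:
  assumes "f \<in> schwartz"
  shows "(\<lambda>y. chirp \<alpha> y * f y) \<in> schwartz"
proof (rule schwartz_coinduct[where P = "\<lambda>h. \<exists>f\<in>schwartz. h = (\<lambda>y. chirp \<alpha> y * f y)"])
  fix h :: "real^2 \<Rightarrow> complex" and \<beta> :: "2 \<Rightarrow> nat"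
  assume "\<exists>f\<in>schwartz. h = (\<lambda>y. chirp \<alpha> y * f y)"
  then obtain f where f: "f \<in> schwartz" "h = (\<lambda>y. chirp \<alpha> y * f y)" by auto
  then show "\<exists>B. \<forall>y. norm ((\<Prod>j\<in>UNIV. (y $ j) ^ \<beta> j) *\<^sub>R h y) \<le> B"
    using schwartz_monomial_bound[OF f(1), of \<beta>] by (simp add: norm_mult norm_chirp)
next
  fix h :: "real^2 \<Rightarrow> complex"
  assume "\<exists>f\<in>schwartz. h = (\<lambda>y. chirp \<alpha> y * f y)"
  then obtain f where f: "f \<in> schwartz" "h = (\<lambda>y. chirp \<alpha> y * f y)" by auto
  have d: "(h has_derivative (\<lambda>v. chirp \<alpha> y * (dir_deriv v f y + \<i> * (\<Sum>k\<in>UNIV. complex_of_real (v $ k) *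
     (complex_of_real (cot (\<alpha> $ k)) * complex_of_real (y $ k))) * f y))) (at y)" for y
    unfolding f using has_derivative_dir_deriv[OF schwartz_differentiable[OF f(1)]]
    by (auto intro!: derivative_eq_intros has_derivative_chirp simp: algebra_simps)
  show "h differentiable (at y)" for y using d by (auto simp: differentiable_def)
  show "\<exists>f\<in>schwartz. partial_derivative k h = (\<lambda>y. chirp \<alpha> y * f y)" for k
  proof (intro bexI)
    have "(\<Sum>i\<in>UNIV. complex_of_real (axis k 1 $ i) * (complex_of_real (cot (\<alpha> $ i)) * complex_of_real (y $ i)))
      = complex_of_real (cot (\<alpha> $ k)) * complex_of_real (y $ k)" for y
    proof -
      have "(\<Sum>i\<in>UNIV. complex_of_real (axis k 1 $ i) * (complex_of_real (cot (\<alpha> $ i)) * complex_of_real (y $ i)))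
        = (\<Sum>i\<in>UNIV. if i = k then complex_of_real (cot (\<alpha> $ i)) * complex_of_real (y $ i) else 0)"
        by (intro sum.cong) (auto simp: axis_def)
      then show ?thesis by simp
    qed
    then show "partial_derivative k h = (\<lambda>y. chirp \<alpha> y * (partial_derivative k f y +
        \<i> * complex_of_real (cot (\<alpha> $ k)) * (complex_of_real (y $ k) * f y)))"
      by (auto simp: partial_derivative_eq[OF d] dir_deriv_axis)
  qed (intro schwartz_add schwartz_cmult schwartz_coordinate_mult schwartz_partial_derivative f)
qed (use assms in auto)

section \<open>Taylor estimates for differences, uniform in the base point\<close>

lemma vector_derivative_norm_bound:
  fixes \<psi> :: "real \<Rightarrow> complex"
  assumes "\<And>s. (\<psi> has_vector_derivative \<psi>' s) (at s)" "\<And>s. 0 \<le> s \<Longrightarrow> s \<le> t \<Longrightarrow> cmod (\<psi>' s) \<le> K" "0 \<le> t"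
  shows "cmod (\<psi> t - \<psi> 0) \<le> K * t"
proof -
  have "norm (\<psi> t - \<psi> 0) \<le> K * norm (t - 0)"
  proof (rule differentiable_bound)
    fix s assume s: "s \<in> {0..t}"
    show "(\<psi> has_derivative (\<lambda>h. h *\<^sub>R \<psi>' s)) (at s within {0..t})"
      using assms(1)[of s] by (auto simp: has_vector_derivative_def intro: has_derivative_at_withinI)
    show "onorm (\<lambda>h. h *\<^sub>R \<psi>' s) \<le> K"
      using assms(2)[of s] s by (intro onorm_le) (auto simp: mult.commute[of K] intro!: mult_left_mono)
  qed (use assms in auto)
  then show ?thesis using assms(3) by simp
qed

lemma has_vector_derivative_dir_deriv:
  assumes "f \<in> schwartz"
  shows "((\<lambda>s. f (x + s *\<^sub>R v)) has_vector_derivative dir_deriv v f (x + s *\<^sub>R v)) (at s)"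
proof -
  have d: "(f has_derivative (\<lambda>w. dir_deriv w f (x + s *\<^sub>R v))) (at (x + s *\<^sub>R v))"
    using assms by (intro has_derivative_dir_deriv schwartz_differentiable)
  have "((\<lambda>s. f (x + s *\<^sub>R v)) has_derivative (\<lambda>h. dir_deriv (h *\<^sub>R v) f (x + s *\<^sub>R v))) (at s)"
    using d by (intro has_derivative_compose[of "\<lambda>s. x + s *\<^sub>R v" "\<lambda>h. h *\<^sub>R v" s UNIV f
        "\<lambda>w. dir_deriv w f (x + s *\<^sub>R v)"]) (auto intro!: derivative_eq_intros)
  moreover have "dir_deriv (h *\<^sub>R v) f y = h *\<^sub>R dir_deriv v f y" for h y
    unfolding dir_deriv_def vector_scaleR_component of_real_mult
    by (simp add: scaleR_conv_of_real sum_distrib_left mult.assoc)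
  ultimately show ?thesis by (simp add: has_vector_derivative_def)
qed

lemma schwartz_Lipschitz:
  fixes f :: "real^'n::finite \<Rightarrow> complex"
  assumes "f \<in> schwartz"
  obtains M where "M \<ge> 0" "\<And>x y. cmod (f (x + y) - f x) \<le> M * norm y"
proof -
  have "\<forall>k. \<exists>B. 0 \<le> B \<and> (\<forall>y. cmod (partial_derivative k f y) \<le> B)"
    using schwartz_bounded[OF schwartz_partial_derivative[OF assms]] by blast
  from choice[OF this]
  obtain B where B: "\<And>k. B k \<ge> 0" "\<And>k y. cmod (partial_derivative k f y) \<le> B k"
    by blast
  define M where "M = (\<Sum>k\<in>UNIV. B k)"
  have dd: "cmod (dir_deriv v f y) \<le> M * norm v" for v y
  proof -
    have "cmod (dir_deriv v f y) \<le> (\<Sum>k\<in>UNIV. cmod (complex_of_real (v $ k) * partial_derivative k f y))"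
      unfolding dir_deriv_def by (rule norm_sum)
    also have "\<dots> \<le> (\<Sum>k\<in>UNIV. norm v * B k)"
      unfolding norm_mult norm_of_real using B by (intro sum_mono mult_mono component_le_norm_cart) auto
    finally show ?thesis by (simp add: M_def sum_distrib_left mult.commute)
  qed
  have "cmod (f (x + y) - f x) \<le> M * norm y" for x y
    using vector_derivative_norm_bound[OF has_vector_derivative_dir_deriv[OF assms, of x y], of 1 "M * norm y"] dd[of y]
    by simp
  moreover have "M \<ge> 0" using B by (simp add: M_def sum_nonneg)
  ultimately show ?thesis using that by blast
qed

text \<open>The mean value inequality for f minus its linear part along the ray. The directional
  derivative has a global Lipschitz constant, which makes \<open>M\<close> independent of x.\<close>

lemma schwartz_taylor1:
  fixes f :: "real^'n::finite \<Rightarrow> complex"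
  assumes f: "f \<in> schwartz"
  obtains M where "M \<ge> 0"
    "\<And>x t. 0 \<le> t \<Longrightarrow> cmod (f (x + t *\<^sub>R v) - f x - t *\<^sub>R dir_deriv v f x) \<le> M * t\<^sup>2"
proof -
  obtain L where L: "L \<ge> 0" "\<And>x y. cmod (dir_deriv v f (x + y) - dir_deriv v f x) \<le> L * norm y"
    using schwartz_Lipschitz[OF schwartz_dir_deriv[OF f]] by blast
  have "cmod (f (x + t *\<^sub>R v) - f x - t *\<^sub>R dir_deriv v f x) \<le> (L * norm v) * t\<^sup>2" if t: "0 \<le> t" for x t
  proof -
    have "((\<lambda>s. f (x + s *\<^sub>R v) - s *\<^sub>R dir_deriv v f x) has_vector_derivative
        (dir_deriv v f (x + s *\<^sub>R v) - dir_deriv v f x)) (at s)" for s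
      by (auto intro!: derivative_eq_intros has_vector_derivative_dir_deriv[OF f])
    moreover have "cmod (dir_deriv v f (x + s *\<^sub>R v) - dir_deriv v f x) \<le> L * (t * norm v)" if "0 \<le> s" "s \<le> t" for s
    proof -
      have "L * norm (s *\<^sub>R v) \<le> L * (t * norm v)" using that L(1) by (auto intro!: mult_mono)
      then show ?thesis using L(2)[of x "s *\<^sub>R v"] by linarith
    qed
    ultimately have "cmod (f (x + t *\<^sub>R v) - t *\<^sub>R dir_deriv v f x - (f (x + 0 *\<^sub>R v) - 0 *\<^sub>R dir_deriv v f x))
        \<le> L * (t * norm v) * t"
      using t by (intro vector_derivative_norm_bound) blast+
    then show ?thesis by (simp add: power2_eq_square algebra_simps)
  qed
  then show ?thesis using that[of "L * norm v"] L(1) by simp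
qed

lemma dir_deriv_uminus: "dir_deriv (- v) f x = - dir_deriv v f x"
  by (simp add: dir_deriv_def sum_negf)

lemma schwartz_dif_approx:
  fixes f :: "real^'n::finite \<Rightarrow> complex"
  assumes f: "f \<in> schwartz"
  obtains M where "M \<ge> 0"
    "\<And>x t. 0 \<le> t \<Longrightarrow> cmod (dif (t *\<^sub>R v) f x - t *\<^sub>R dir_deriv v f x) \<le> M * t\<^sup>2"
proof -
  obtain M where M: "M \<ge> 0" "\<And>x t. 0 \<le> t \<Longrightarrow> cmod (f (x + t *\<^sub>R v) - f x - t *\<^sub>R dir_deriv v f x) \<le> M * t\<^sup>2"
    using schwartz_taylor1[OF f] by blast
  obtain N where N: "N \<ge> 0" "\<And>x t. 0 \<le> t \<Longrightarrow> cmod (f (x + t *\<^sub>R (-v)) - f x - t *\<^sub>R dir_deriv (-v) f x) \<le> N * t\<^sup>2"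
    using schwartz_taylor1[OF f] by blast
  have "cmod (dif (t *\<^sub>R v) f x - t *\<^sub>R dir_deriv v f x) \<le> (M + N) * t\<^sup>2" if "0 \<le> t" for x t
  proof -
    let ?X = "f (x + t *\<^sub>R v) - f x - t *\<^sub>R dir_deriv v f x" and ?Y = "f (x + t *\<^sub>R (-v)) - f x - t *\<^sub>R dir_deriv (-v) f x"
    have "dif (t *\<^sub>R v) f x - t *\<^sub>R dir_deriv v f x = (?X - ?Y) / 2"
      by (simp add: dif_def dir_deriv_uminus field_simps)
    also have "cmod \<dots> = cmod (?X - ?Y) / 2" by (simp only: norm_divide norm_numeral)
    also have "\<dots> \<le> cmod ?X + cmod ?Y"
      using norm_triangle_ineq4[of ?X ?Y] norm_ge_zero[of "?X - ?Y"] by linarith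
    finally show ?thesis using M(2)[OF that, of x] N(2)[OF that, of x] by (simp add: distrib_right)
  qed
  then show ?thesis using that[of "M + N"] M N by simp
qed

text \<open>The function f(x + s v) + f(x - s v) minus its quadratic term has a derivative
  controlled by the first-order estimate for the directional derivative. Its increment over [0, 2 t]
  is four times the quantity to be bounded, because two half-differences of step t reach out to 2
  t.\<close>

lemma schwartz_dif_dif_approx:
  fixes f :: "real^'n::finite \<Rightarrow> complex"
  assumes f: "f \<in> schwartz"
  obtains M where "M \<ge> 0"
    "\<And>x t. 0 \<le> t \<Longrightarrow> cmod (dif (t *\<^sub>R v) (dif (t *\<^sub>R v) f) x - t\<^sup>2 *\<^sub>R dir_deriv v (dir_deriv v f) x) \<le> M * t ^ 3"
proof -
  let ?D = "dir_deriv v f"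
  obtain M where M: "M \<ge> 0" "\<And>x t. 0 \<le> t \<Longrightarrow> cmod (dif (t *\<^sub>R v) ?D x - t *\<^sub>R dir_deriv v ?D x) \<le> M * t\<^sup>2"
    using schwartz_dif_approx[OF schwartz_dir_deriv[OF f]] by blast
  have "cmod (dif (t *\<^sub>R v) (dif (t *\<^sub>R v) f) x - t\<^sup>2 *\<^sub>R dir_deriv v ?D x) \<le> (4 * M) * t ^ 3" if t: "0 \<le> t" for x t
  proof -
    let ?\<psi> = "\<lambda>s. f (x + s *\<^sub>R v) + f (x + s *\<^sub>R (-v)) - s\<^sup>2 *\<^sub>R dir_deriv v ?D x"
    have "cmod (?\<psi> (2 * t) - ?\<psi> 0) \<le> 2 * (M * (2 * t)\<^sup>2) * (2 * t)"
    proof (rule vector_derivative_norm_bound)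
      fix s :: real
      show "(?\<psi> has_vector_derivative (?D (x + s *\<^sub>R v) + dir_deriv (-v) f (x + s *\<^sub>R (-v)) -
          (2 * s) *\<^sub>R dir_deriv v ?D x)) (at s)"
      proof (intro has_vector_derivative_diff has_vector_derivative_add has_vector_derivative_dir_deriv[OF f])
        show "((\<lambda>s. s\<^sup>2 *\<^sub>R dir_deriv v ?D x) has_vector_derivative (2 * s) *\<^sub>R dir_deriv v ?D x) (at s)"
          by (auto intro!: derivative_eq_intros)
      qed
      assume s: "0 \<le> s" "s \<le> 2 * t"
      have "?D (x + s *\<^sub>R v) + dir_deriv (-v) f (x + s *\<^sub>R (-v)) - (2 * s) *\<^sub>R dir_deriv v ?D x
        = 2 * (dif (s *\<^sub>R v) ?D x - s *\<^sub>R dir_deriv v ?D x)"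
        by (simp add: dif_def dir_deriv_uminus scaleR_conv_of_real algebra_simps)
      also have "cmod \<dots> \<le> 2 * (M * s\<^sup>2)" 
        using M(2)[OF s(1), of x] by (simp only: norm_mult norm_numeral)
      also have "\<dots> \<le> 2 * (M * (2 * t)\<^sup>2)"
        using s M(1) by (intro mult_left_mono power_mono) auto
      finally show "cmod (?D (x + s *\<^sub>R v) + dir_deriv (-v) f (x + s *\<^sub>R (-v)) - (2 * s) *\<^sub>R dir_deriv v ?D x)
        \<le> 2 * (M * (2 * t)\<^sup>2)" .
    qed (use t in simp)
    moreover have "?\<psi> (2 * t) - ?\<psi> 0 = 4 * (dif (t *\<^sub>R v) (dif (t *\<^sub>R v) f) x - t\<^sup>2 *\<^sub>R dir_deriv v ?D x)"
      by (simp add: dif_dif scaleR_conv_of_real algebra_simps)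
    ultimately have "4 * cmod (dif (t *\<^sub>R v) (dif (t *\<^sub>R v) f) x - t\<^sup>2 *\<^sub>R dir_deriv v ?D x)
        \<le> 2 * (M * (2 * t)\<^sup>2) * (2 * t)"
      by (simp only: norm_mult norm_numeral)
    then show ?thesis by (simp add: power2_eq_square power3_eq_cube)
  qed
  then show ?thesis using that[of "4 * M"] M by simp
qed

text \<open>The mean value inequality in direction a, applied to the difference of f across t b. The
  mixed second difference is symmetric in a and b, which is what makes the estimate useful.\<close>

lemma dir_deriv_mixed_difference:
  fixes f :: "real^'n::finite \<Rightarrow> complex"
  assumes f: "f \<in> schwartz"
  obtains C where "\<And>t. 0 \<le> t \<Longrightarrow> cmod (f (x + t *\<^sub>R a + t *\<^sub>R b) - f (x + t *\<^sub>R a) - f (x + t *\<^sub>R b) + f x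
      - t\<^sup>2 *\<^sub>R dir_deriv b (dir_deriv a f) x) \<le> C * t ^ 3"
proof -
  let ?A = "dir_deriv a f"
  obtain M where M: "\<And>x t. 0 \<le> t \<Longrightarrow> cmod (?A (x + t *\<^sub>R b) - ?A x - t *\<^sub>R dir_deriv b ?A x) \<le> M * t\<^sup>2"
    using schwartz_taylor1[OF schwartz_dir_deriv[OF f]] by blast
  obtain L where L: "L \<ge> 0" "\<And>x y. cmod (dir_deriv b ?A (x + y) - dir_deriv b ?A x) \<le> L * norm y"
    using schwartz_Lipschitz[OF schwartz_dir_deriv[OF schwartz_dir_deriv[OF f]]] by blast
  have "cmod (f (x + t *\<^sub>R a + t *\<^sub>R b) - f (x + t *\<^sub>R a) - f (x + t *\<^sub>R b) + f x
      - t\<^sup>2 *\<^sub>R dir_deriv b ?A x) \<le> (M + L * norm a) * t ^ 3" if t: "0 \<le> t" for t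
  proof -
    let ?\<psi> = "\<lambda>s. f (x + t *\<^sub>R b + s *\<^sub>R a) - f (x + s *\<^sub>R a) - s *\<^sub>R (t *\<^sub>R dir_deriv b ?A x)"
    have "cmod (?\<psi> t - ?\<psi> 0) \<le> (M * t\<^sup>2 + t * (L * (t * norm a))) * t"
    proof (rule vector_derivative_norm_bound)
      fix s :: real
      show "(?\<psi> has_vector_derivative (?A (x + t *\<^sub>R b + s *\<^sub>R a) - ?A (x + s *\<^sub>R a) - t *\<^sub>R dir_deriv b ?A x)) (at s)"
        by (auto intro!: derivative_eq_intros has_vector_derivative_dir_deriv[OF f])
      assume s: "0 \<le> s" "s \<le> t"
      \<comment> \<open>The first part is a Taylor remainder at the moving point x + s a, the second
        the oscillation of the mixed derivative between that point and x.\<close>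
      have "?A (x + t *\<^sub>R b + s *\<^sub>R a) - ?A (x + s *\<^sub>R a) - t *\<^sub>R dir_deriv b ?A x =
        (?A (x + s *\<^sub>R a + t *\<^sub>R b) - ?A (x + s *\<^sub>R a) - t *\<^sub>R dir_deriv b ?A (x + s *\<^sub>R a)) +
        t *\<^sub>R (dir_deriv b ?A (x + s *\<^sub>R a) - dir_deriv b ?A x)"
        by (simp add: algebra_simps)
      also have "cmod \<dots> \<le> M * t\<^sup>2 + t * (L * (t * norm a))"
      proof (intro norm_triangle_mono)
        have "cmod (dir_deriv b ?A (x + s *\<^sub>R a) - dir_deriv b ?A x) \<le> L * (t * norm a)"
          by (rule order_trans[OF L(2)]) (use s L(1) in \<open>auto intro!: mult_mono\<close>)
        then show "cmod (t *\<^sub>R (dir_deriv b ?A (x + s *\<^sub>R a) - dir_deriv b ?A x)) \<le> t * (L * (t * norm a))"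
          using t by (simp add: mult_left_mono)
      qed (rule M[OF t])
      finally show "cmod (?A (x + t *\<^sub>R b + s *\<^sub>R a) - ?A (x + s *\<^sub>R a) - t *\<^sub>R dir_deriv b ?A x)
        \<le> M * t\<^sup>2 + t * (L * (t * norm a))" .
    qed (use t in simp)
    moreover have "?\<psi> t - ?\<psi> 0 = f (x + t *\<^sub>R a + t *\<^sub>R b) - f (x + t *\<^sub>R a) - f (x + t *\<^sub>R b) + f x
      - t\<^sup>2 *\<^sub>R dir_deriv b ?A x"
      by (simp add: power2_eq_square algebra_simps)
    ultimately show ?thesis by (simp add: power2_eq_square power3_eq_cube algebra_simps)
  qed
  then show ?thesis using that by blast
qed

text \<open>Both orders of differentiation approximate t^-2 times the same second difference with
  error O(t).\<close>

lemma dir_deriv_commute: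
  fixes f :: "real^'n::finite \<Rightarrow> complex"
  assumes f: "f \<in> schwartz"
  shows "dir_deriv b (dir_deriv a f) = dir_deriv a (dir_deriv b f)"
proof
  fix x
  let ?\<Delta> = "\<lambda>t. f (x + t *\<^sub>R a + t *\<^sub>R b) - f (x + t *\<^sub>R a) - f (x + t *\<^sub>R b) + f x"
  let ?p = "dir_deriv b (dir_deriv a f) x" and ?q = "dir_deriv a (dir_deriv b f) x"
  obtain C where C: "\<And>t. 0 \<le> t \<Longrightarrow> cmod (?\<Delta> t - t\<^sup>2 *\<^sub>R ?p) \<le> C * t ^ 3"
    using dir_deriv_mixed_difference[OF f, of x a b] by blast
  obtain D where D: "\<And>t. 0 \<le> t \<Longrightarrow> cmod (f (x + t *\<^sub>R b + t *\<^sub>R a) - f (x + t *\<^sub>R b) - f (x + t *\<^sub>R a) + f x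
      - t\<^sup>2 *\<^sub>R ?q) \<le> D * t ^ 3"
    using dir_deriv_mixed_difference[OF f, of x b a] by blast
  have le: "cmod (?p - ?q) \<le> (C + D) * t" if t: "t > 0" for t
  proof -
    define X where "X = f (x + t *\<^sub>R b + t *\<^sub>R a) - f (x + t *\<^sub>R b) - f (x + t *\<^sub>R a) + f x - t\<^sup>2 *\<^sub>R ?q"
    define Y where "Y = ?\<Delta> t - t\<^sup>2 *\<^sub>R ?p"
    have "cmod X \<le> D * t ^ 3" "cmod Y \<le> C * t ^ 3"
      unfolding X_def Y_def using t C[of t] D[of t] by auto
    then have "cmod (X - Y) \<le> (C + D) * t ^ 3"
      using norm_triangle_ineq4[of X Y] by (simp add: distrib_right)
    moreover have "X - Y = t\<^sup>2 *\<^sub>R (?p - ?q)"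
      by (simp add: X_def Y_def algebra_simps)
    ultimately have "t\<^sup>2 * cmod (?p - ?q) \<le> (C + D) * t ^ 3"
      by (simp only: norm_scaleR abs_power2)
    also have "\<dots> = t\<^sup>2 * ((C + D) * t)"
      by (simp add: power2_eq_square power3_eq_cube)
    finally have "t\<^sup>2 * cmod (?p - ?q) \<le> t\<^sup>2 * ((C + D) * t)" .
    then show ?thesis using t by simp
  qed
  have "((\<lambda>t. (C + D) * t) \<longlongrightarrow> (C + D) * 0) (at_right 0)" by (intro tendsto_intros)
  then have "cmod (?p - ?q) \<le> (C + D) * 0"
    by (rule tendsto_lowerbound) (auto intro!: eventually_at_right_less[THEN eventually_mono] le)
  then show "?p = ?q" by simp
qed

section \<open>Boundedness and square integrability of Schwartz functions\<close>

lemma schwartz_bounded_measurable: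
  assumes "f \<in> schwartz"
  shows "bounded_measurable f"
proof -
  have "continuous_on UNIV f"
    using schwartz_differentiable[OF assms] by (auto intro!: continuous_at_imp_continuous_on differentiable_imp_continuous_within)
  then have "f \<in> borel_measurable borel" by (rule borel_measurable_continuous_onI)
  then show ?thesis using schwartz_bounded[OF assms] unfolding bounded_measurable_def by metis
qed

text \<open>Each weight 1 + y_j^2 is the identity plus two coordinate multiplications. For the full
  index set this gives decay like the integrable product of all 1 / (1 + y_k^2).\<close>

lemma schwartz_prod_mult:
  fixes f :: "real^'n::finite \<Rightarrow> complex"
  assumes f: "f \<in> schwartz" and "finite S"
  shows "(\<lambda>y. complex_of_real (\<Prod>k\<in>S. 1 + (y $ k)\<^sup>2) * f y) \<in> schwartz"
  using assms(2)
proof induction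
  case (insert j S)
  let ?h = "\<lambda>y. complex_of_real (\<Prod>k\<in>S. 1 + (y $ k)\<^sup>2) * f y"
  have "(\<lambda>y. ?h y + complex_of_real (y $ j) * (complex_of_real (y $ j) * ?h y)) \<in> schwartz"
    by (intro schwartz_add schwartz_coordinate_mult insert)
  moreover have "(\<lambda>y. ?h y + complex_of_real (y $ j) * (complex_of_real (y $ j) * ?h y)) =
      (\<lambda>y. complex_of_real (\<Prod>k\<in>insert j S. 1 + (y $ k)\<^sup>2) * f y)"
    using insert by (auto simp: fun_eq_iff power2_eq_square algebra_simps)
  ultimately show ?case by simp
qed (use f in simp)

lemma nn_integral_inverse_1_plus_square: "(\<integral>\<^sup>+x. ennreal (1 / (1 + x\<^sup>2)) \<partial>lborel) < \<infinity>"
proof -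
  let ?f = "\<lambda>x::real. ennreal (1 / (1 + x\<^sup>2))"
  have fin: "(\<integral>\<^sup>+x\<in>{0..}. ?f x \<partial>lborel) < \<infinity>"
  proof -
    have "(\<integral>\<^sup>+x\<in>{0..}. ?f x \<partial>lborel) = ennreal (pi / 2 - arctan 0)"
    proof (rule nn_integral_FTC_atLeast)
      show "DERIV arctan x :> 1 / (1 + x\<^sup>2)" for x
        using DERIV_arctan[of x] by (simp add: inverse_eq_divide)
      show "(arctan \<longlongrightarrow> pi / 2) at_top" by (rule tendsto_arctan_at_top)
    qed auto
    then show ?thesis by simp
  qed
  have "(\<integral>\<^sup>+x. ?f x \<partial>lborel) \<le> (\<integral>\<^sup>+x. ?f x * indicator {0..} x + ?f (-x) * indicator {0..} (-x) \<partial>lborel)"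
    by (intro nn_integral_mono) (auto simp: indicator_def)
  also have "\<dots> = (\<integral>\<^sup>+x\<in>{0..}. ?f x \<partial>lborel) + (\<integral>\<^sup>+x. ?f (-x) * indicator {0..} (-x) \<partial>lborel)"
    by (intro nn_integral_add) auto
  also have "(\<integral>\<^sup>+x. ?f (-x) * indicator {0..} (-x) \<partial>lborel) = (\<integral>\<^sup>+x\<in>{0..}. ?f x \<partial>lborel)"
    using nn_integral_real_affine[of "\<lambda>x. ?f x * indicator {0..} x" "-1" 0] by simp
  also have "(\<integral>\<^sup>+x\<in>{0..}. ?f x \<partial>lborel) + (\<integral>\<^sup>+x\<in>{0..}. ?f x \<partial>lborel) < \<infinity>" using fin by simp
  finally show ?thesis .
qed

text \<open>One factor of |f|^2 is bounded by a constant, the other by a multiple of the product of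
  1 / (1 + y_k^2), whose integral factorises.\<close>

lemma schwartz_energy_finite:
  fixes f :: "real^'n::finite \<Rightarrow> complex"
  assumes f: "f \<in> schwartz"
  shows "energy f < \<infinity>"
proof -
  obtain B where B: "B \<ge> 0" "\<And>y. cmod (f y) \<le> B" using schwartz_bounded[OF f] by blast
  obtain C where C: "C \<ge> 0" "\<And>y. cmod (complex_of_real (\<Prod>k\<in>UNIV. 1 + (y $ k)\<^sup>2) * f y) \<le> C"
    using schwartz_bounded[OF schwartz_prod_mult[OF f finite]] by blast
  \<comment> \<open>Bridge between products over \<open>Basis\<close>, along which Lebesgue measure
    factorises, and products over coordinates.\<close>
  have ax: "(\<Prod>b\<in>Basis. h (y \<bullet> b)) = (\<Prod>k\<in>UNIV. h (y $ k))" for h :: "real \<Rightarrow> real" and y :: "real^'n"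
  proof -
    have "Basis = range (\<lambda>k. axis k 1 :: real^'n)" by (auto simp: Basis_vec_def)
    moreover have "inj (\<lambda>k. axis k 1 :: real^'n)" by (auto intro!: injI simp: axis_eq_axis)
    ultimately have "(\<Prod>b\<in>Basis. h (y \<bullet> b)) = prod ((\<lambda>b. h (y \<bullet> b)) \<circ> (\<lambda>k. axis k 1)) UNIV"
      using prod.reindex by metis
    then show ?thesis by (simp add: inner_axis)
  qed
  have "energy f \<le> (\<integral>\<^sup>+y. ennreal (B * C) * (\<Prod>b\<in>Basis. ennreal (1 / (1 + (y \<bullet> b)\<^sup>2))) \<partial>(lborel :: (real^'n) measure))"
    unfolding energy_def
  proof (intro nn_integral_mono)
    fix y :: "real^'n"
    let ?P = "\<Prod>k\<in>UNIV. 1 + (y $ k)\<^sup>2"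
    have P: "?P > 0" by (intro prod_pos) (auto intro: add_pos_nonneg)
    have "cmod (f y) \<le> C / ?P" using C(2)[of y] P unfolding norm_mult norm_of_real by (simp add: field_simps)
    then have "(cmod (f y))\<^sup>2 \<le> B * (C / ?P)"
      unfolding power2_eq_square using B by (intro mult_mono) auto
    also have "\<dots> = (B * C) * (\<Prod>b\<in>Basis. 1 / (1 + (y \<bullet> b)\<^sup>2))"
      using ax[of "\<lambda>t. 1 / (1 + t\<^sup>2)" y] by (simp add: prod_dividef)
    finally have "ennreal ((cmod (f y))\<^sup>2) \<le> ennreal ((B * C) * (\<Prod>b\<in>Basis. 1 / (1 + (y \<bullet> b)\<^sup>2)))"
      by (rule ennreal_leI)
    also have "\<dots> = ennreal (B * C) * (\<Prod>b\<in>Basis. ennreal (1 / (1 + (y \<bullet> b)\<^sup>2)))"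
      using B C by (simp add: ennreal_mult prod_nonneg prod_ennreal)
    finally show "ennreal ((cmod (f y))\<^sup>2) \<le> ennreal (B * C) * (\<Prod>b\<in>Basis. ennreal (1 / (1 + (y \<bullet> b)\<^sup>2)))" .
  qed
  also have "\<dots> = ennreal (B * C) * (\<Prod>b\<in>(Basis :: (real^'n) set). (\<integral>\<^sup>+x. ennreal (1 / (1 + x\<^sup>2)) \<partial>lborel))"
    by (subst nn_integral_cmult, measurable, subst nn_integral_lborel_prod) auto
  also have "\<dots> < \<infinity>"
    using nn_integral_inverse_1_plus_square
    by (simp add: ennreal_mult_less_top power_less_top_ennreal)
  finally show ?thesis .
qed

section \<open>The Beurling transform as a limit of walk transforms\<close>

lemma norm_sum_list_diff_le:
  fixes X Y :: "'i \<Rightarrow> complex"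
  assumes "\<And>j. j \<in> set l \<Longrightarrow> cmod (X j - Y j) \<le> b" "\<And>j. j \<in> set l \<Longrightarrow> cmod (\<sigma> j) \<le> 1"
  shows "cmod ((\<Sum>j\<leftarrow>l. \<sigma> j * X j) - (\<Sum>j\<leftarrow>l. \<sigma> j * Y j)) \<le> real (length l) * b"
  using assms
proof (induction l)
  case (Cons i l)
  have "(\<Sum>j\<leftarrow>i # l. \<sigma> j * X j) - (\<Sum>j\<leftarrow>i # l. \<sigma> j * Y j) =
      \<sigma> i * (X i - Y i) + ((\<Sum>j\<leftarrow>l. \<sigma> j * X j) - (\<Sum>j\<leftarrow>l. \<sigma> j * Y j))"
    by (simp add: algebra_simps)
  also have "cmod \<dots> \<le> 1 * b + real (length l) * b"
  proof (rule norm_triangle_mono)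
    show "cmod (\<sigma> i * (X i - Y i)) \<le> 1 * b"
      unfolding norm_mult using Cons.prems by (intro mult_mono) auto
  qed (use Cons in auto)
  finally show ?case by (simp add: algebra_simps)
qed simp

text \<open>The true order is t^4, but t^3 matches the other errors of a round. The inner second
  difference is t^2 times a Lipschitz second derivative plus an O(t^3) remainder, and differencing
  the Lipschitz part gains one more factor t.\<close>

lemma schwartz_dif_dif_dif_dif_le:
  fixes f :: "real^'n::finite \<Rightarrow> complex"
  assumes f: "f \<in> schwartz"
  obtains M where "M \<ge> 0"
    "\<And>x t. 0 \<le> t \<Longrightarrow> cmod (dif (t *\<^sub>R a) (dif (t *\<^sub>R a) (dif (t *\<^sub>R b) (dif (t *\<^sub>R b) f))) x) \<le> M * t ^ 3"
proof -
  let ?H = "dir_deriv b (dir_deriv b f)"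
  obtain M where M: "M \<ge> 0"
    "\<And>x t. 0 \<le> t \<Longrightarrow> cmod (dif (t *\<^sub>R b) (dif (t *\<^sub>R b) f) x - t\<^sup>2 *\<^sub>R ?H x) \<le> M * t ^ 3"
    using schwartz_dif_dif_approx[OF f] by blast
  obtain L where L: "L \<ge> 0" "\<And>x y. cmod (?H (x + y) - ?H x) \<le> L * norm y"
    using schwartz_Lipschitz[OF schwartz_dir_deriv[OF schwartz_dir_deriv[OF f]]] by blast
  have "cmod (dif (t *\<^sub>R a) (dif (t *\<^sub>R a) (dif (t *\<^sub>R b) (dif (t *\<^sub>R b) f))) x) \<le> (M + L * norm a) * t ^ 3"
    if t: "0 \<le> t" for x t
  proof -
    let ?a = "t *\<^sub>R a"
    define E where "E = (\<lambda>x. dif (t *\<^sub>R b) (dif (t *\<^sub>R b) f) x - t\<^sup>2 *\<^sub>R ?H x)"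
    have eq: "dif (t *\<^sub>R b) (dif (t *\<^sub>R b) f) = (\<lambda>x. E x + complex_of_real (t\<^sup>2) * ?H x)"
      by (simp add: E_def fun_eq_iff scaleR_conv_of_real)
    have "cmod (dif ?a ?H y) \<le> L * (t * norm a)" for y
    proof -
      have shift: "y - ?a + (?a + ?a) = y + ?a" by (simp only: diff_add_cancel add.assoc[symmetric])
      have "cmod (?H (y - ?a + (?a + ?a)) - ?H (y - ?a)) \<le> L * norm (?a + ?a)" by (rule L(2))
      also have "\<dots> \<le> L * (norm ?a + norm ?a)" using L(1) by (intro mult_left_mono norm_triangle_ineq)
      finally have "cmod (?H (y + ?a) - ?H (y - ?a)) \<le> 2 * (L * (t * norm a))"
        unfolding shift using t by simp
      then show ?thesis by (simp add: dif_def norm_divide)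
    qed
    then have 1: "cmod (dif ?a (dif ?a ?H) x) \<le> L * (t * norm a)" by (rule norm_dif_le)
    have "cmod (dif ?a (dif ?a E) x) \<le> M * t ^ 3"
      using M(2)[OF t] by (intro norm_dif_le) (simp add: E_def)
    moreover have "cmod (complex_of_real (t\<^sup>2) * dif ?a (dif ?a ?H) x) \<le> t\<^sup>2 * (L * (t * norm a))"
      unfolding norm_mult norm_of_real abs_power2 using 1 by (intro mult_left_mono) auto
    ultimately have "cmod (dif ?a (dif ?a E) x + complex_of_real (t\<^sup>2) * dif ?a (dif ?a ?H) x) \<le>
        M * t ^ 3 + t\<^sup>2 * (L * (t * norm a))"
      by (rule norm_triangle_mono)
    then show ?thesis
      unfolding eq dif_add dif_cmult by (simp add: power2_eq_square power3_eq_cube algebra_simps)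
  qed
  then show ?thesis using that[of "M + L * norm a"] M(1) L(1) by simp
qed

text \<open>Two errors of order t^3 are added: freezing the function during the round, and replacing
  second differences by second derivatives. Their constants are summed over the finitely many steps
  that occur in \<open>l\<close>.\<close>

lemma walk_transform_approx:
  fixes f :: "real^'n::finite \<Rightarrow> complex"
  assumes f: "f \<in> schwartz" and \<sigma>: "\<And>j. j \<in> set l \<Longrightarrow> cmod (\<sigma> j) \<le> 1"
  obtains M where "M \<ge> 0" "\<And>x t. 0 \<le> t \<Longrightarrow> cmod (walk_transform \<sigma> (\<lambda>j. t *\<^sub>R d j) l f x -
      t\<^sup>2 *\<^sub>R (\<Sum>j\<leftarrow>l. \<sigma> j * dir_deriv (d j) (dir_deriv (d j) f) x)) \<le> M * t ^ 3"
proof -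
  have "\<forall>j. \<exists>M. 0 \<le> M \<and> (\<forall>x t. 0 \<le> t \<longrightarrow>
      cmod (dif (t *\<^sub>R d j) (dif (t *\<^sub>R d j) f) x - t\<^sup>2 *\<^sub>R dir_deriv (d j) (dir_deriv (d j) f) x) \<le> M * t ^ 3)"
    using schwartz_dif_dif_approx[OF f] by metis
  from choice[OF this] obtain M where M: "\<And>j. M j \<ge> 0" "\<And>j x t. 0 \<le> t \<Longrightarrow>
      cmod (dif (t *\<^sub>R d j) (dif (t *\<^sub>R d j) f) x - t\<^sup>2 *\<^sub>R dir_deriv (d j) (dir_deriv (d j) f) x) \<le> M j * t ^ 3"
    by blast
  have "\<forall>i. \<forall>j. \<exists>N. 0 \<le> N \<and> (\<forall>x t. 0 \<le> t \<longrightarrow>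
      cmod (dif (t *\<^sub>R d i) (dif (t *\<^sub>R d i) (dif (t *\<^sub>R d j) (dif (t *\<^sub>R d j) f))) x) \<le> N * t ^ 3)"
    using schwartz_dif_dif_dif_dif_le[OF f] by metis
  \<comment> \<open>Indexing by pairs lets a single choice function serve both directions.\<close>
  then have "\<exists>N. \<forall>ij. 0 \<le> N ij \<and> (\<forall>x t. 0 \<le> t \<longrightarrow> cmod (dif (t *\<^sub>R d (fst ij)) (dif (t *\<^sub>R d (fst ij))
      (dif (t *\<^sub>R d (snd ij)) (dif (t *\<^sub>R d (snd ij)) f))) x) \<le> N ij * t ^ 3)"
    by (intro choice) auto
  then obtain N where N: "\<And>ij. N ij \<ge> 0" "\<And>i j x t. 0 \<le> t \<Longrightarrow>
      cmod (dif (t *\<^sub>R d i) (dif (t *\<^sub>R d i) (dif (t *\<^sub>R d j) (dif (t *\<^sub>R d j) f))) x) \<le> N (i, j) * t ^ 3"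
    by (metis fst_conv snd_conv)
  define A where "A = (\<Sum>ij\<in>set l \<times> set l. N ij)"
  define C where "C = (\<Sum>j\<in>set l. M j)"
  have A: "A \<ge> 0" and C: "C \<ge> 0" using M N by (auto simp: A_def C_def intro!: sum_nonneg)
  have "cmod (walk_transform \<sigma> (\<lambda>j. t *\<^sub>R d j) l f x -
      t\<^sup>2 *\<^sub>R (\<Sum>j\<leftarrow>l. \<sigma> j * dir_deriv (d j) (dir_deriv (d j) f) x)) \<le>
      ((real (length l))\<^sup>2 * A + real (length l) * C) * t ^ 3" if t: "0 \<le> t" for x t
  proof -
    let ?S = "\<Sum>j\<leftarrow>l. \<sigma> j * dif (t *\<^sub>R d j) (dif (t *\<^sub>R d j) f) x"
    have 1: "cmod (walk_transform \<sigma> (\<lambda>j. t *\<^sub>R d j) l f x - ?S) \<le> (real (length l))\<^sup>2 * (A * t ^ 3)"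
    proof (rule walk_transform_expansion)
      fix i j x assume "i \<in> set l" "j \<in> set l"
      then have "N (i, j) \<le> A" unfolding A_def using N by (intro member_le_sum) auto
      then have "N (i, j) * t ^ 3 \<le> A * t ^ 3" using t by (intro mult_right_mono) auto
      then show "cmod (dif (t *\<^sub>R d i) (dif (t *\<^sub>R d i) (dif (t *\<^sub>R d j) (dif (t *\<^sub>R d j) f))) x) \<le> A * t ^ 3"
        using N(2)[OF t, of i j x] by linarith
    qed (use A t \<sigma> in auto)
    have 2: "cmod (?S - (\<Sum>j\<leftarrow>l. \<sigma> j * (t\<^sup>2 *\<^sub>R dir_deriv (d j) (dir_deriv (d j) f) x))) \<le> real (length l) * (C * t ^ 3)"
    proof (rule norm_sum_list_diff_le)
      fix j assume "j \<in> set l"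
      then have "M j \<le> C" unfolding C_def using M by (intro member_le_sum) auto
      then have "M j * t ^ 3 \<le> C * t ^ 3" using t by (intro mult_right_mono) auto
      then show "cmod (dif (t *\<^sub>R d j) (dif (t *\<^sub>R d j) f) x - t\<^sup>2 *\<^sub>R dir_deriv (d j) (dir_deriv (d j) f) x) \<le> C * t ^ 3"
        using M(2)[OF t, of j x] by linarith
    qed (use \<sigma> in auto)
    have 3: "(\<Sum>j\<leftarrow>l. \<sigma> j * (t\<^sup>2 *\<^sub>R dir_deriv (d j) (dir_deriv (d j) f) x)) =
        t\<^sup>2 *\<^sub>R (\<Sum>j\<leftarrow>l. \<sigma> j * dir_deriv (d j) (dir_deriv (d j) f) x)"
      by (induction l) (simp_all add: scaleR_add_right)
    show ?thesis using norm_triangle_mono[OF 1 2] unfolding 3 by (simp add: algebra_simps)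
  qed
  then show ?thesis using that[of "(real (length l))\<^sup>2 * A + real (length l) * C"] A C by simp
qed

text \<open>These steps realise \<open>3 \<Delta> w = 3 (\<partial>\<^sub>1 - i \<partial>\<^sub>2)\<^sup>2 u\<close>: the two diagonal directions express the mixed derivative as a
  difference of two pure second derivatives; the weights are divided by 3 to have
  modulus at most 1, which is compensated by replacing u by \<open>3 * u\<close>.\<close>

definition step_dir :: "nat \<Rightarrow> real^2" where
  "step_dir j = [axis 1 1, axis 2 1, axis 1 1 + axis 2 1, axis 1 1 - axis 2 1] ! j"

definition step_weight :: "nat \<Rightarrow> complex" where
  "step_weight j = [1, -1, - \<i> / 2, \<i> / 2] ! j"

abbreviation walk_round :: "nat list" where
  "walk_round \<equiv> [0, 1, 2, 3]"

text \<open>Twice the Wirtinger derivative with respect to the conjugate variable;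
  \<open>dhol\<close> is its holomorphic counterpart.\<close>

definition dbar :: "(real^2 \<Rightarrow> complex) \<Rightarrow> real^2 \<Rightarrow> complex" where
  "dbar g y = partial_derivative 1 g y + \<i> * partial_derivative 2 g y"

definition dhol :: "(real^2 \<Rightarrow> complex) \<Rightarrow> real^2 \<Rightarrow> complex" where
  "dhol g y = partial_derivative 1 g y + (- \<i>) * partial_derivative 2 g y"

lemma schwartz_dbar: "g \<in> schwartz \<Longrightarrow> dbar g \<in> schwartz"
  unfolding dbar_def[abs_def] by (intro schwartz_add schwartz_cmult schwartz_partial_derivative)

lemma schwartz_dhol: "g \<in> schwartz \<Longrightarrow> dhol g \<in> schwartz"
  unfolding dhol_def[abs_def] by (intro schwartz_add schwartz_cmult schwartz_partial_derivative)

lemma dir_deriv_diagonal: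
  "dir_deriv (axis 1 1 + axis 2 1) f = (\<lambda>y. partial_derivative 1 f y + partial_derivative (2::2) f y)"
  "dir_deriv (axis 1 1 - axis 2 1) f = (\<lambda>y. partial_derivative 1 f y + (- 1) * partial_derivative (2::2) f y)"
  by (simp_all add: dir_deriv_def[abs_def] sum_2 axis_def)

lemma schwartz_diff:
  assumes "f \<in> schwartz" "g \<in> schwartz"
  shows "(\<lambda>y. f y - g y) \<in> schwartz"
  using schwartz_add[OF assms(1) schwartz_cmult[OF assms(2), of "-1"]] by simp

lemma partial_derivative_diff:
  assumes "f \<in> schwartz" "g \<in> schwartz"
  shows "partial_derivative k (\<lambda>y. f y - g y) = (\<lambda>y. partial_derivative k f y - partial_derivative k g y)"
  using partial_derivative_add[OF assms(1) schwartz_cmult[OF assms(2), of "-1"]]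
    partial_derivative_cmult[OF assms(2), of k "-1"] by simp

lemma partial_derivative_commute:
  "f \<in> schwartz \<Longrightarrow> partial_derivative i (partial_derivative j f) = partial_derivative j (partial_derivative i f)"
  using dir_deriv_commute[of f "axis i 1" "axis j 1"] by (simp add: dir_deriv_axis)

text \<open>The two diagonal second derivatives add up to twice the Laplacian and differ by 4 D12.
  Equal weights thus give three Laplacians, while the weights -i/2 and i/2 leave -2 i D12, which
  completes the square of d_1 - i d_2.\<close>

lemma step_dir_second_derivatives:
  assumes f: "f \<in> schwartz"
  defines "D \<equiv> \<lambda>i j. partial_derivative i (partial_derivative j f)"
  shows "(\<Sum>j\<leftarrow>walk_round. 1 * dir_deriv (step_dir j) (dir_deriv (step_dir j) f) y) = 3 * (D 1 1 y + D 2 2 y)"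
    and "(\<Sum>j\<leftarrow>walk_round. step_weight j * dir_deriv (step_dir j) (dir_deriv (step_dir j) f) y) =
      D 1 1 y - D 2 2 y - 2 * \<i> * D 1 2 y"
proof -
  have sym: "partial_derivative 2 (partial_derivative 1 f) = partial_derivative 1 (partial_derivative 2 f)"
    by (rule partial_derivative_commute[OF f])
  note S = schwartz_diff schwartz_add schwartz_cmult schwartz_partial_derivative f
  note R = step_dir_def step_weight_def dir_deriv_axis dir_deriv_diagonal
        partial_derivative_add partial_derivative_diff partial_derivative_cmult S sym D_def
  show "(\<Sum>j\<leftarrow>walk_round. 1 * dir_deriv (step_dir j) (dir_deriv (step_dir j) f) y) = 3 * (D 1 1 y + D 2 2 y)"
    by (simp add: R)
  show "(\<Sum>j\<leftarrow>walk_round. step_weight j * dir_deriv (step_dir j) (dir_deriv (step_dir j) f) y) =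
      D 1 1 y - D 2 2 y - 2 * \<i> * D 1 2 y"
    by (simp add: R) (simp add: field_simps)
qed

text \<open>Both sides are 3 (d_1 - i d_2)^2 (d_1 + i d_2) g, by the factorisation of the Laplacian.
  Hence the transform of \<open>dhol g\<close> with weights 1 and that of \<open>3 * dbar g\<close>
  with \<open>step_weight\<close> agree to leading order in each round.\<close>

lemma step_laplace_identity:
  assumes g: "g \<in> schwartz"
  shows "(\<Sum>j\<leftarrow>walk_round. 1 * dir_deriv (step_dir j) (dir_deriv (step_dir j) (dhol g)) y) =
    (\<Sum>j\<leftarrow>walk_round. step_weight j * dir_deriv (step_dir j) (dir_deriv (step_dir j) (\<lambda>x. 3 * dbar g x)) y)"
proof -
  note S = schwartz_add schwartz_cmult schwartz_partial_derivative g
  let ?D = "partial_derivative :: 2 \<Rightarrow> _"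
  have sym: "?D 2 (?D 1 f) = ?D 1 (?D 2 f)" if "f \<in> schwartz" for f
    by (rule partial_derivative_commute[OF that])
  have w: "?D i (?D j (dhol g)) = (\<lambda>y. ?D i (?D j (?D 1 g)) y + (- \<i>) * ?D i (?D j (?D 2 g)) y)" for i j
    unfolding dhol_def[abs_def] by (simp only: partial_derivative_add partial_derivative_cmult S)
  have u: "?D i (?D j (\<lambda>x. 3 * dbar g x)) = (\<lambda>y. 3 * (?D i (?D j (?D 1 g)) y + \<i> * ?D i (?D j (?D 2 g)) y))" for i j
    unfolding dbar_def[abs_def] by (simp only: partial_derivative_add partial_derivative_cmult S)
  show ?thesis
    unfolding step_dir_second_derivatives(1)[OF schwartz_dhol[OF g]]
      step_dir_second_derivatives(2)[OF schwartz_cmult[OF schwartz_dbar[OF g]]] w u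
    by (simp add: sym S) (simp add: algebra_simps)
qed

section \<open>Passage to small steps and long times\<close>

lemma integral_mult_norm_le:
  fixes \<Phi> F :: "'a::euclidean_space \<Rightarrow> complex"
  assumes "integrable lborel \<Phi>" "\<And>x. cmod (F x) \<le> M" "F \<in> borel_measurable borel"
  shows "cmod (\<integral>x. \<Phi> x * F x \<partial>lborel) \<le> M * (\<integral>x. cmod (\<Phi> x) \<partial>lborel)"
proof -
  have i: "integrable lborel (\<lambda>x. \<Phi> x * F x)"
    using assms by (intro integrable_mult_bounded) (auto simp: bounded_measurable_def)
  have "cmod (\<integral>x. \<Phi> x * F x \<partial>lborel) \<le> (\<integral>x. cmod (\<Phi> x * F x) \<partial>lborel)"
    by (rule integral_norm_bound)
  also have "\<dots> \<le> (\<integral>x. M * cmod (\<Phi> x) \<partial>lborel)"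
  proof (rule integral_mono)
    show "integrable lborel (\<lambda>x. cmod (\<Phi> x * F x))" by (rule integrable_norm[OF i])
  qed (use assms in \<open>auto simp: norm_mult mult.commute[of M] mult_left_mono\<close>)
  finally show ?thesis by simp
qed

text \<open>An additive form of Cauchy-Schwarz, sqrt N |\<Phi> F| <= |\<Phi>|^2 + N |F|^2, shaped
  for an energy that decays like 1 / N.\<close>

lemma integral_mult_energy_le:
  fixes \<Phi> F :: "'a::euclidean_space \<Rightarrow> complex"
  assumes \<Phi>: "integrable lborel \<Phi>" and F: "bounded_measurable F"
    and e\<Phi>: "energy \<Phi> \<le> ennreal A" and eF: "of_nat N * energy F \<le> ennreal C"
    and N: "N > 0" and nn: "A \<ge> 0" "C \<ge> 0"
  shows "cmod (\<integral>x. \<Phi> x * F x \<partial>lborel) \<le> (A + C) / sqrt N"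
proof -
  have [measurable]: "\<Phi> \<in> borel_measurable borel" "F \<in> borel_measurable borel"
    using \<Phi> F by (auto simp: bounded_measurable_def)
  define s where "s = sqrt N"
  have s: "s > 0" "s * s = N" using N by (auto simp: s_def)
  have "ennreal (s * cmod (\<integral>x. \<Phi> x * F x \<partial>lborel)) = ennreal s * ennreal (cmod (\<integral>x. \<Phi> x * F x \<partial>lborel))"
    using s by (simp add: ennreal_mult)
  also have "\<dots> \<le> ennreal s * (\<integral>\<^sup>+x. ennreal (cmod (\<Phi> x * F x)) \<partial>lborel)"
    using integrable_mult_bounded[OF \<Phi> F] by (intro mult_left_mono integral_norm_bound_ennreal) auto
  also have "\<dots> = (\<integral>\<^sup>+x. ennreal s * ennreal (cmod (\<Phi> x * F x)) \<partial>lborel)"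
    by (intro nn_integral_cmult[symmetric]) measurable
  also have "\<dots> \<le> (\<integral>\<^sup>+x. ennreal ((cmod (\<Phi> x))\<^sup>2) + of_nat N * ennreal ((cmod (F x))\<^sup>2) \<partial>lborel)"
  proof (intro nn_integral_mono)
    fix x
    have "0 \<le> (cmod (\<Phi> x) - s * cmod (F x))\<^sup>2" by simp
    then have "2 * (s * cmod (\<Phi> x * F x)) \<le> (cmod (\<Phi> x))\<^sup>2 + s * s * (cmod (F x))\<^sup>2"
      by (simp add: norm_mult power2_eq_square algebra_simps)
    moreover have "s * cmod (\<Phi> x * F x) \<ge> 0" using s by simp
    ultimately have "s * cmod (\<Phi> x * F x) \<le> (cmod (\<Phi> x))\<^sup>2 + real N * (cmod (F x))\<^sup>2"
      unfolding s(2) by linarith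
    then have "ennreal (s * cmod (\<Phi> x * F x)) \<le> ennreal ((cmod (\<Phi> x))\<^sup>2 + real N * (cmod (F x))\<^sup>2)"
      by (rule ennreal_leI)
    then show "ennreal s * ennreal (cmod (\<Phi> x * F x)) \<le> ennreal ((cmod (\<Phi> x))\<^sup>2) + of_nat N * ennreal ((cmod (F x))\<^sup>2)"
      using s by (simp add: ennreal_mult ennreal_of_nat_eq_real_of_nat)
  qed
  also have "\<dots> = (\<integral>\<^sup>+x. ennreal ((cmod (\<Phi> x))\<^sup>2) \<partial>lborel) + (\<integral>\<^sup>+x. of_nat N * ennreal ((cmod (F x))\<^sup>2) \<partial>lborel)"
    by (rule nn_integral_add) measurable
  also have "\<dots> = energy \<Phi> + of_nat N * energy F"
    unfolding energy_def by (subst nn_integral_cmult) auto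
  also have "\<dots> \<le> ennreal (A + C)" using e\<Phi> eF nn by (simp add: add_mono)
  finally have "s * cmod (\<integral>x. \<Phi> x * F x \<partial>lborel) \<le> A + C"
    using nn by (subst (asm) ennreal_le_iff) auto
  then show ?thesis using s by (simp add: s_def[symmetric] field_simps)
qed

text \<open>A first derivative of g is, up to O(t), a difference of g divided by t. The energy of
  such differences drops like 1 / N along the walk, which becomes 1 / (t sqrt N) after pairing with
  \<Phi>.\<close>

lemma dhol_walk_average_decay:
  fixes \<Phi> :: "real^2 \<Rightarrow> complex"
  assumes g: "g \<in> schwartz" and \<Phi>: "integrable lborel \<Phi>" "energy \<Phi> < \<infinity>"
  obtains C where "C \<ge> 0" "\<And>t N. 0 < t \<Longrightarrow> 0 < N \<Longrightarrow>
    cmod (\<integral>x. \<Phi> x * avgs (\<lambda>j. t *\<^sub>R step_dir j) (concat (replicate N walk_round)) (dhol g) x \<partial>lborel)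
    \<le> C * t + C / (t * sqrt N)"
proof -
  obtain M1 where M1: "M1 \<ge> 0" "\<And>x t. 0 \<le> t \<Longrightarrow>
      cmod (dif (t *\<^sub>R axis 1 1) g x - t *\<^sub>R dir_deriv (axis 1 1) g x) \<le> M1 * t\<^sup>2"
    using schwartz_dif_approx[OF g] by blast
  obtain M2 where M2: "M2 \<ge> 0" "\<And>x t. 0 \<le> t \<Longrightarrow>
      cmod (dif (t *\<^sub>R axis 2 1) g x - t *\<^sub>R dir_deriv (axis 2 1) g x) \<le> M2 * t\<^sup>2"
    using schwartz_dif_approx[OF g] by blast
  obtain A where A: "A \<ge> 0" "energy \<Phi> = ennreal A"
    using \<Phi>(2) by (cases "energy \<Phi>") auto
  obtain G where G: "G \<ge> 0" "energy g = ennreal G"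
    using schwartz_energy_finite[OF g] by (cases "energy g") auto
  define I where "I = (\<integral>x. cmod (\<Phi> x) \<partial>lborel)"
  have I: "I \<ge> 0" by (simp add: I_def)
  have bg: "bounded_measurable g" by (rule schwartz_bounded_measurable[OF g])
  \<comment> \<open>The first summand is the coefficient of t, the second that of 1 / (t sqrt N);
    their sum serves for both.\<close>
  define C where "C = (M1 + M2) * I + 2 * (A + G)"
  have "cmod (\<integral>x. \<Phi> x * avgs (\<lambda>j. t *\<^sub>R step_dir j) (concat (replicate N walk_round)) (dhol g) x \<partial>lborel)
    \<le> C * t + C / (t * sqrt N)" if t: "0 < t" and N: "0 < N" for t N
  proof -
    let ?l = "concat (replicate N walk_round)" and ?d = "\<lambda>j. t *\<^sub>R step_dir j"
    let ?a1 = "t *\<^sub>R axis 1 1 :: real^2" and ?a2 = "t *\<^sub>R axis 2 1 :: real^2"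
    let ?g = "avgs ?d ?l g"
    have d01: "?d 0 = ?a1" "?d 1 = ?a2" by (simp_all add: step_dir_def)
    \<comment> \<open>Divided differences in place of the partial derivatives of
      \<open>dhol g\<close>; the remainder \<open>E\<close> is O(t) uniformly.\<close>
    define h where "h = (\<lambda>x. (1 / complex_of_real t) * dif ?a1 g x + (- \<i> / complex_of_real t) * dif ?a2 g x)"
    define E where "E = (\<lambda>x. dhol g x + (-1) * h x)"
    have bmh: "bounded_measurable h"
      unfolding h_def by (intro bounded_measurable_add bounded_measurable_cmult bounded_measurable_dif bg)
    have bmE: "bounded_measurable E"
      unfolding E_def by (intro bounded_measurable_add bounded_measurable_cmult bmh
          schwartz_bounded_measurable schwartz_dhol g)
    have E_le: "cmod (E x) \<le> (M1 + M2) * t" for x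
    proof -
      let ?X = "dif ?a1 g x - t *\<^sub>R dir_deriv (axis 1 1) g x" and ?Y = "dif ?a2 g x - t *\<^sub>R dir_deriv (axis 2 1) g x"
      have "complex_of_real t * E x = \<i> * ?Y - ?X"
        using t by (simp add: E_def h_def dhol_def dir_deriv_axis scaleR_conv_of_real field_simps)
      then have "t * cmod (E x) = cmod (\<i> * ?Y - ?X)"
        using t by (metis abs_of_pos norm_mult norm_of_real)
      also have "\<dots> \<le> cmod (\<i> * ?Y) + cmod ?X" by (rule norm_triangle_ineq4)
      also have "\<dots> \<le> M2 * t\<^sup>2 + M1 * t\<^sup>2"
        unfolding norm_mult using M1(2)[of t x] M2(2)[of t x] t by simp
      also have "\<dots> = t * ((M1 + M2) * t)" by (simp add: power2_eq_square algebra_simps)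
      finally show ?thesis using t by (simp only: mult_le_cancel_left_pos)
    qed
    have "avgs ?d ?l (dhol g) = avgs ?d ?l (\<lambda>x. h x + E x)" by (simp add: E_def)
    also have "\<dots> = (\<lambda>x. ((1 / complex_of_real t) * dif ?a1 ?g x + (- \<i> / complex_of_real t) * dif ?a2 ?g x) + avgs ?d ?l E x)"
      by (simp only: avgs_add h_def avgs_cmult avgs_dif)
    finally have eq: "avgs ?d ?l (dhol g) x = (1 / complex_of_real t) * dif ?a1 ?g x +
        (- \<i> / complex_of_real t) * dif ?a2 ?g x + avgs ?d ?l E x" for x by simp
    have bmg: "bounded_measurable (dif a ?g)" for a
      by (intro bounded_measurable_dif bounded_measurable_avgs bg)
    have en: "cmod (\<integral>x. \<Phi> x * dif (?d j) ?g x \<partial>lborel) \<le> (A + G) / sqrt N" if "j \<in> set walk_round" for j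
    proof (rule integral_mult_energy_le[OF \<Phi>(1) bmg])
      have "of_nat N * energy (dif (?d j) ?g) \<le> energy ?g + of_nat N * energy (dif (?d j) ?g)" by simp
      also have "\<dots> \<le> energy g"
        using bg by (intro energy_rounds_dif_le[OF that]) (simp add: bounded_measurable_def)
      finally show "of_nat N * energy (dif (?d j) ?g) \<le> ennreal G" using G by simp
    qed (use A G N in auto)
    have en1: "cmod (\<integral>x. \<Phi> x * dif ?a1 ?g x \<partial>lborel) \<le> (A + G) / sqrt N"
      and en2: "cmod (\<integral>x. \<Phi> x * dif ?a2 ?g x \<partial>lborel) \<le> (A + G) / sqrt N"
      using en[of 0] en[of 1] unfolding d01 by simp_all
    have err: "cmod (\<integral>x. \<Phi> x * avgs ?d ?l E x \<partial>lborel) \<le> ((M1 + M2) * t) * I"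
      unfolding I_def
      using bounded_measurable_avgs[OF bmE, unfolded bounded_measurable_def]
      by (intro integral_mult_norm_le[OF \<Phi>(1)] norm_avgs_le E_le) (rule conjunct1)
    have int: "integrable lborel (\<lambda>x. \<Phi> x * dif a ?g x)" "integrable lborel (\<lambda>x. \<Phi> x * avgs ?d ?l E x)" for a
      by (intro integrable_mult_bounded \<Phi> bmg bounded_measurable_avgs bmE)+
    have "(\<integral>x. \<Phi> x * avgs ?d ?l (dhol g) x \<partial>lborel) =
        (\<integral>x. (1 / complex_of_real t) * (\<Phi> x * dif ?a1 ?g x) +
          (- \<i> / complex_of_real t) * (\<Phi> x * dif ?a2 ?g x) + \<Phi> x * avgs ?d ?l E x \<partial>lborel)"
      unfolding eq by (intro Bochner_Integration.integral_cong) (use t in \<open>auto simp: field_simps\<close>)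
    also have "\<dots> = (1 / complex_of_real t) * (\<integral>x. \<Phi> x * dif ?a1 ?g x \<partial>lborel) +
          (- \<i> / complex_of_real t) * (\<integral>x. \<Phi> x * dif ?a2 ?g x \<partial>lborel) + (\<integral>x. \<Phi> x * avgs ?d ?l E x \<partial>lborel)"
      using int by (simp add: Bochner_Integration.integral_add Bochner_Integration.integral_diff)
    also have "cmod \<dots> \<le> (1 / t) * ((A + G) / sqrt N) + (1 / t) * ((A + G) / sqrt N) + ((M1 + M2) * t) * I"
    proof (intro norm_triangle_mono err)
      show "cmod ((1 / complex_of_real t) * (\<integral>x. \<Phi> x * dif ?a1 ?g x \<partial>lborel)) \<le> (1 / t) * ((A + G) / sqrt N)"
        using mult_left_mono[OF en1, of "1 / t"] t by (simp add: norm_mult norm_divide)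
      show "cmod ((- \<i> / complex_of_real t) * (\<integral>x. \<Phi> x * dif ?a2 ?g x \<partial>lborel)) \<le> (1 / t) * ((A + G) / sqrt N)"
        using mult_left_mono[OF en2, of "1 / t"] t by (simp add: norm_mult norm_divide)
    qed
    also have "\<dots> = ((M1 + M2) * I) * t + 2 * (A + G) / (t * sqrt N)"
      by (simp add: add_divide_distrib algebra_simps)
    also have "\<dots> \<le> C * t + C / (t * sqrt N)"
      using t N A G M1(1) M2(1) I unfolding C_def
      by (intro add_mono mult_right_mono divide_right_mono) auto
    finally show ?thesis .
  qed
  moreover have "C \<ge> 0" using M1 M2 I A G by (simp add: C_def)
  ultimately show ?thesis using that by blast
qed

text \<open>The pairing with w splits into the pairing with the walk average of w, with the
  accumulated discrepancy of the two transforms, and with the transform of 3 u. Only the last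
  survives the limit, and \<open>J\<close> bounds it for every step size and length.\<close>

lemma dhol_bilinear_bound:
  fixes \<Phi> :: "real^2 \<Rightarrow> complex"
  assumes g: "g \<in> schwartz" and \<Phi>: "integrable lborel \<Phi>" "energy \<Phi> < \<infinity>"
    and J: "\<And>d l. set l \<subseteq> set walk_round \<Longrightarrow>
      cmod (\<integral>x. \<Phi> x * walk_transform step_weight d l (\<lambda>x. 3 * dbar g x) x \<partial>lborel) \<le> J"
  shows "cmod (\<integral>x. \<Phi> x * dhol g x \<partial>lborel) \<le> J"
proof -
  let ?u = "\<lambda>x. 3 * dbar g x" and ?w = "dhol g"
  have weight: "cmod (step_weight j) \<le> 1" if "j \<in> set walk_round" for j
    using that by (auto simp: step_weight_def norm_divide)
  have u: "?u \<in> schwartz" and w: "?w \<in> schwartz"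
    using g by (simp_all add: schwartz_cmult schwartz_dbar schwartz_dhol)
  obtain M1 where M1: "M1 \<ge> 0" "\<And>x t. 0 \<le> t \<Longrightarrow>
      cmod (walk_transform step_weight (\<lambda>j. t *\<^sub>R step_dir j) walk_round ?u x -
      t\<^sup>2 *\<^sub>R (\<Sum>j\<leftarrow>walk_round. step_weight j * dir_deriv (step_dir j) (dir_deriv (step_dir j) ?u) x)) \<le> M1 * t ^ 3"
    using walk_transform_approx[OF u, of walk_round step_weight step_dir] weight by blast
  obtain M2 where M2: "M2 \<ge> 0" "\<And>x t. 0 \<le> t \<Longrightarrow>
      cmod (walk_transform (\<lambda>_. 1) (\<lambda>j. t *\<^sub>R step_dir j) walk_round ?w x -
      t\<^sup>2 *\<^sub>R (\<Sum>j\<leftarrow>walk_round. 1 * dir_deriv (step_dir j) (dir_deriv (step_dir j) ?w) x)) \<le> M2 * t ^ 3"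
    using walk_transform_approx[OF w, of walk_round "\<lambda>_. 1" step_dir] by auto
  define M where "M = M1 + M2"
  have round: "cmod (walk_transform step_weight (\<lambda>j. t *\<^sub>R step_dir j) walk_round ?u x -
      walk_transform (\<lambda>_. 1) (\<lambda>j. t *\<^sub>R step_dir j) walk_round ?w x) \<le> M * t ^ 3" if "0 \<le> t" for x t
    using norm_triangle_mono[OF M1(2)[OF that, of x] M2(2)[OF that, of x, unfolded norm_minus_commute[of "walk_transform _ _ _ _ _"]]]
    unfolding step_laplace_identity[OF g] by (simp add: M_def algebra_simps)
  obtain C where C: "C \<ge> 0" "\<And>t N. 0 < t \<Longrightarrow> 0 < N \<Longrightarrow>
    cmod (\<integral>x. \<Phi> x * avgs (\<lambda>j. t *\<^sub>R step_dir j) (concat (replicate N walk_round)) ?w x \<partial>lborel)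
    \<le> C * t + C / (t * sqrt N)"
    using dhol_walk_average_decay[OF g \<Phi>] by blast
  define I where "I = (\<integral>x. cmod (\<Phi> x) \<partial>lborel)"
  have bound: "cmod (\<integral>x. \<Phi> x * ?w x \<partial>lborel) \<le> J + (real N * (M * t ^ 3)) * I + (C * t + C / (t * sqrt N))"
    if t: "0 < t" and N: "0 < N" for t N
  proof -
    let ?l = "concat (replicate N walk_round)" and ?d = "\<lambda>j. t *\<^sub>R step_dir j"
    let ?U = "walk_transform step_weight ?d ?l ?u" and ?W = "walk_transform (\<lambda>_. 1) ?d ?l ?w"
    have bm: "bounded_measurable ?U" "bounded_measurable ?W" "bounded_measurable (avgs ?d ?l ?w)"
      by (intro bounded_measurable_walk_transform bounded_measurable_avgs schwartz_bounded_measurable u w)+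
    then have bmD: "bounded_measurable (\<lambda>x. ?U x + (-1) * ?W x)"
      by (intro bounded_measurable_add bounded_measurable_cmult)
    have D_le: "cmod (?U x + (-1) * ?W x) \<le> real N * (M * t ^ 3)" for x
      using walk_transform_rounds[OF round, of t N x] t by simp
    have int: "integrable lborel (\<lambda>x. \<Phi> x * ?U x)" "integrable lborel (\<lambda>x. \<Phi> x * avgs ?d ?l ?w x)"
      "integrable lborel (\<lambda>x. \<Phi> x * (?U x + (-1) * ?W x))"
      by (intro integrable_mult_bounded \<Phi> bm bmD)+
    have "(\<integral>x. \<Phi> x * ?w x \<partial>lborel) =
        (\<integral>x. (\<Phi> x * (?U x + (-1) * ?W x) - \<Phi> x * ?U x) + \<Phi> x * avgs ?d ?l ?w x \<partial>lborel)"
      by (intro Bochner_Integration.integral_cong) (auto simp: walk_transform_one algebra_simps)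
    also have "\<dots> = (\<integral>x. \<Phi> x * (?U x + (-1) * ?W x) \<partial>lborel) - (\<integral>x. \<Phi> x * ?U x \<partial>lborel) +
        (\<integral>x. \<Phi> x * avgs ?d ?l ?w x \<partial>lborel)"
      using int by (simp only: Bochner_Integration.integral_add Bochner_Integration.integral_diff
          Bochner_Integration.integrable_diff)
    also have "cmod \<dots> \<le> ((real N * (M * t ^ 3)) * I + J) + (C * t + C / (t * sqrt N))"
    proof (rule norm_triangle_mono)
      have "cmod (\<integral>x. \<Phi> x * (?U x + (-1) * ?W x) \<partial>lborel) \<le> (real N * (M * t ^ 3)) * I"
        unfolding I_def using bmD D_le
        by (intro integral_mult_norm_le \<Phi>) (auto simp: bounded_measurable_def)
      moreover have "cmod (\<integral>x. \<Phi> x * ?U x \<partial>lborel) \<le> J"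
        by (rule J) auto
      ultimately show "cmod ((\<integral>x. \<Phi> x * (?U x + (-1) * ?W x) \<partial>lborel) - (\<integral>x. \<Phi> x * ?U x \<partial>lborel))
          \<le> (real N * (M * t ^ 3)) * I + J"
        by (intro order_trans[OF norm_triangle_ineq4] add_mono)
    qed (rule C(2)[OF t N])
    finally show ?thesis by simp
  qed
  \<comment> \<open>With t = n^-2 and N = n^5 the errors N t^3, t and 1 / (t sqrt N) become n^-1,
    n^-2 and n^(-1/2).\<close>
  have "(\<lambda>n. 1 / real n) \<longlonglongrightarrow> 0" "(\<lambda>n. 1 / (real n)\<^sup>2) \<longlonglongrightarrow> 0" "(\<lambda>n. 1 / sqrt (real n)) \<longlonglongrightarrow> 0"
    by real_asymp+
  then have "(\<lambda>n. J + (M * (1 / real n)) * I + (C * (1 / (real n)\<^sup>2) + C * (1 / sqrt (real n))))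
      \<longlonglongrightarrow> J + (M * 0) * I + (C * 0 + C * 0)"
    by (intro tendsto_intros)
  moreover have "cmod (\<integral>x. \<Phi> x * ?w x \<partial>lborel) \<le> J + (M * (1 / real n)) * I + (C * (1 / (real n)\<^sup>2) + C * (1 / sqrt (real n)))"
    if n: "n \<ge> 1" for n
  proof -
    have n0: "real n > 0" using n by simp
    have "real (n ^ 5) * (M * (1 / (real n)\<^sup>2) ^ 3) = M * (1 / real n)"
      using n0 by (simp add: power_divide field_simps flip: power_mult power_Suc)
    moreover have "1 / (real n)\<^sup>2 * sqrt (real (n ^ 5)) = sqrt (real n)"
    proof -
      have "real (n ^ 5) = ((real n)\<^sup>2)\<^sup>2 * real n" by (simp add: power2_eq_square eval_nat_numeral)
      then have "sqrt (real (n ^ 5)) = (real n)\<^sup>2 * sqrt (real n)"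
        by (simp only: real_sqrt_mult real_sqrt_abs abs_power2)
      then show ?thesis using n0 by simp
    qed
    ultimately show ?thesis using bound[of "1 / (real n)\<^sup>2" "n ^ 5"] n0 by simp
  qed
  ultimately have "cmod (\<integral>x. \<Phi> x * ?w x \<partial>lborel) \<le> J + (M * 0) * I + (C * 0 + C * 0)"
    by (intro LIMSEQ_le_const) auto
  then show ?thesis by simp
qed

section \<open>The estimate in \<open>L\<^sup>p\<close>\<close>

text \<open>Replacing (u, v) by (s u, v / s) leaves the product |h| |k|, hence the gain, unchanged,
  but shifts weight between the two powers, so the coefficient of |v|^q can be made as small as
  desired.\<close>

lemma scaled_bellman_fun_exists:
  fixes p q \<delta> :: real
  assumes pq: "1 < p" "1 < q" "1 / p + 1 / q = 1" and \<delta>: "\<delta> > 0"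
  obtains B :: "complex \<Rightarrow> complex \<Rightarrow> real" and C where
    "\<And>F G :: 'm::euclidean_space \<Rightarrow> complex. F \<in> borel_measurable borel \<Longrightarrow> G \<in> borel_measurable borel \<Longrightarrow>
      (\<lambda>x. B (F x) (G x)) \<in> borel_measurable borel"
    "\<And>u v. 0 \<le> B u v" "C > 0"
    "\<And>u v. B u v \<le> C * cmod u powr p + \<delta> * cmod v powr q"
    "\<And>u v h k. B u v + cmod h * cmod k \<le> (B (u + h) (v + k) + B (u - h) (v - k)) / 2"
proof -
  obtain B K where B_meas: "\<And>(F :: 'm \<Rightarrow> complex) (G :: 'm \<Rightarrow> complex) M. F \<in> borel_measurable M \<Longrightarrow> G \<in> borel_measurable M \<Longrightarrow>
      (\<lambda>x. B (F x) (G x)) \<in> borel_measurable M"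
    and B: "\<And>u v. 0 \<le> B u v" "K \<ge> 0"
    "\<And>u v. B u v \<le> K * (cmod u powr p + cmod v powr q)"
    "\<And>u v h k. B u v + cmod h * cmod k \<le> (B (u + h) (v + k) + B (u - h) (v - k)) / 2"
    using complex_bellman_fun_exists[OF pq, where ?'a = 'm] by blast
  \<comment> \<open>This value turns the coefficient (K + 1) s^(-q) of |v|^q into \<delta>; K + 1
    instead of K keeps s positive.\<close>
  define s where "s = ((K + 1) / \<delta>) powr (1 / q)"
  have s: "s > 0" "s powr q = (K + 1) / \<delta>"
    using B(2) \<delta> pq by (simp_all add: s_def powr_powr)
  define Bs where "Bs u v = B (of_real s * u) (of_real (1 / s) * v)" for u v
  show ?thesis
  proof (rule that[of Bs "(K + 1) * s powr p"])
    fix F G :: "'m \<Rightarrow> complex"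
    assume "F \<in> borel_measurable borel" "G \<in> borel_measurable borel"
    then show "(\<lambda>x. Bs (F x) (G x)) \<in> borel_measurable borel"
      unfolding Bs_def by (intro B_meas) auto
  next
    fix u v :: complex
    have "Bs u v \<le> K * (cmod (of_real s * u) powr p + cmod (of_real (1 / s) * v) powr q)"
      unfolding Bs_def by (rule B)
    also have "\<dots> \<le> (K + 1) * (cmod (of_real s * u) powr p + cmod (of_real (1 / s) * v) powr q)"
      by (intro mult_right_mono) auto
    also have "cmod (of_real s * u) powr p = s powr p * cmod u powr p"
      using s by (simp add: norm_mult powr_mult)
    also have "cmod (of_real (1 / s) * v) powr q = \<delta> / (K + 1) * cmod v powr q"
      using s B(2) by (simp add: norm_mult norm_divide powr_divide)
    finally show "Bs u v \<le> (K + 1) * s powr p * cmod u powr p + \<delta> * cmod v powr q"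
      using B(2) by (simp add: distrib_left)
  next
    fix u v h k :: complex
    have "cmod (of_real s * h) * cmod (of_real (1 / s) * k) = cmod h * cmod k"
      using s by (simp add: norm_mult norm_divide)
    then show "Bs u v + cmod h * cmod k \<le> (Bs (u + h) (v + k) + Bs (u - h) (v - k)) / 2"
      using B(4)[of "of_real s * u" "of_real (1 / s) * v" "of_real s * h" "of_real (1 / s) * k"]
      unfolding Bs_def distrib_left right_diff_distrib by simp
  qed (use s B in \<open>auto simp: Bs_def\<close>)
qed

text \<open>Supplies the two requirements on the test function in
  \<open>dhol_bilinear_bound\<close>.\<close>

lemma bounded_ball_supported_integrable:
  fixes \<Phi> :: "'a::euclidean_space \<Rightarrow> complex"
  assumes [measurable]: "\<Phi> \<in> borel_measurable borel" and b: "\<And>x. cmod (\<Phi> x) \<le> M * indicator (ball 0 R) x"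
  shows "integrable lborel \<Phi>" "energy \<Phi> < \<infinity>"
proof -
  have fin: "emeasure lborel (ball (0::'a) R) < \<infinity>" by (rule emeasure_bounded_finite) simp
  have "integrable lborel (\<lambda>x::'a. M * indicator (ball 0 R) x)"
    using fin by (intro integrable_mult_right integrable_real_indicator) auto
  then show "integrable lborel \<Phi>"
    by (rule Bochner_Integration.integrable_bound) (use b in \<open>auto intro!: order_trans[OF b] simp: abs_le_iff\<close>)
  have "energy \<Phi> \<le> (\<integral>\<^sup>+x. ennreal (M\<^sup>2) * indicator (ball 0 R) x \<partial>(lborel :: 'a measure))"
    unfolding energy_def
  proof (intro nn_integral_mono)
    fix x
    have "(cmod (\<Phi> x))\<^sup>2 \<le> (M * indicator (ball 0 R) x)\<^sup>2" using b by (intro power_mono) auto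
    then show "ennreal ((cmod (\<Phi> x))\<^sup>2) \<le> ennreal (M\<^sup>2) * indicator (ball 0 R) x"
      by (auto simp: indicator_def ennreal_leI split: if_splits)
  qed
  also have "\<dots> = ennreal (M\<^sup>2) * emeasure lborel (ball (0::'a) R)"
    by (intro nn_integral_cmult_indicator) auto
  also have "\<dots> < \<infinity>" using fin by (simp add: ennreal_mult_less_top)
  finally show "energy \<Phi> < \<infinity>" .
qed

text \<open>Let I and U be the integrals of |w|^p over a ball and of |u|^p over the plane. Pairing w
  with its extremal test function on the ball gives I <= C 3^p U + I / 2. The ball makes I finite,
  so I / 2 may be subtracted, and the resulting bound does not depend on the radius.\<close>

lemma dhol_Lp_bound:
  assumes p: "1 < p"
  obtains C :: real where "C > 0" "\<And>g. g \<in> schwartz \<Longrightarrow>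
    (\<integral>\<^sup>+y. ennreal (cmod (dhol g y) powr p) \<partial>lborel) \<le> ennreal C * (\<integral>\<^sup>+y. ennreal (cmod (dbar g y) powr p) \<partial>lborel)"
proof -
  define q where "q = p / (p - 1)"
  have q: "1 < q" "1 / p + 1 / q = 1" "(p - 1) * q = p"
    using p by (simp_all add: q_def field_simps)
  obtain B :: "complex \<Rightarrow> complex \<Rightarrow> real" and C where B_meas: "\<And>F G :: real^2 \<Rightarrow> complex.
      F \<in> borel_measurable borel \<Longrightarrow> G \<in> borel_measurable borel \<Longrightarrow>
      (\<lambda>x. B (F x) (G x)) \<in> borel_measurable borel"
    and B: "\<And>u v. 0 \<le> B u v" "C > 0"
    "\<And>u v. B u v \<le> C * cmod u powr p + (1/2) * cmod v powr q"
    "\<And>u v h k. B u v + cmod h * cmod k \<le> (B (u + h) (v + k) + B (u - h) (v - k)) / 2"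
    using scaled_bellman_fun_exists[OF p q(1,2), of "1/2", where ?'m = "real^2"] by auto
  \<comment> \<open>The factor 2 comes from the absorption of I / 2, the power of 3 from working
    with 3 u.\<close>
  define C' where "C' = 2 * C * 3 powr p"
  have "(\<integral>\<^sup>+y. ennreal (cmod (dhol g y) powr p) \<partial>lborel) \<le> ennreal C' * (\<integral>\<^sup>+y. ennreal (cmod (dbar g y) powr p) \<partial>lborel)"
    if g: "g \<in> schwartz" for g
  proof (cases "(\<integral>\<^sup>+y. ennreal (cmod (dbar g y) powr p) \<partial>lborel) = \<infinity>")
    case True
    then show ?thesis using B(2) by (simp add: C'_def ennreal_mult_eq_top_iff)
  next
    case False
    let ?w = "dhol g"
    obtain U where U: "U \<ge> 0" "(\<integral>\<^sup>+y. ennreal (cmod (dbar g y) powr p) \<partial>lborel) = ennreal U"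
      using False by (cases "\<integral>\<^sup>+y. ennreal (cmod (dbar g y) powr p) \<partial>lborel") auto
    have bmw: "bounded_measurable ?w" and bmu: "bounded_measurable (\<lambda>x. 3 * dbar g x)"
      and bmu': "bounded_measurable (dbar g)"
      using g by (simp_all add: schwartz_bounded_measurable schwartz_dhol schwartz_dbar schwartz_cmult)
    then have [measurable]: "?w \<in> borel_measurable borel" "dbar g \<in> borel_measurable borel"
      by (simp_all add: bounded_measurable_def)
    obtain W where W: "W \<ge> 0" "\<And>y. cmod (?w y) \<le> W"
      using schwartz_bounded[OF schwartz_dhol[OF g]] by blast
    have ball: "(\<integral>\<^sup>+y. ennreal (cmod (?w y) powr p) * indicator (ball 0 R) y \<partial>lborel) \<le> ennreal (C' * U)" for R
    proof -
      \<comment> \<open>At zeros of \<open>dhol g\<close> the power has the value 0, so \<Phi>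
        vanishes there even when the exponent p - 2 is negative.\<close>
      define \<Phi> where "\<Phi> y = of_real (indicator (ball 0 R) y * (cmod (?w y) powr (p - 2))) * cnj (?w y)" for y
      have [measurable]: "ball 0 R \<in> sets (borel :: (real^2) measure)" by simp
      have m: "(\<lambda>x. ennreal (cmod (dbar g x) powr p)) \<in> borel_measurable lborel"
        "(\<lambda>x. ennreal (indicator (ball 0 R) x * cmod (?w x) powr p)) \<in> borel_measurable lborel"
        by measurable
      have \<Phi>_meas [measurable]: "\<Phi> \<in> borel_measurable borel"
      proof -
        have "cnj \<in> borel_measurable borel"
          by (intro borel_measurable_continuous_onI continuous_intros)
        then have [measurable]: "(\<lambda>y. cnj (?w y)) \<in> borel_measurable borel"
          by (rule measurable_compose[rotated]) measurable
        show ?thesis unfolding \<Phi>_def[abs_def] by measurable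
      qed
      have norm_\<Phi>: "cmod (\<Phi> y) = indicator (ball 0 R) y * cmod (?w y) powr (p - 1)" for y
        using powr_add[of "cmod (?w y)" "p - 2" 1]
        by (cases "?w y = 0") (auto simp: \<Phi>_def norm_mult abs_mult)
      have \<Phi>w: "\<Phi> y * ?w y = of_real (indicator (ball 0 R) y * cmod (?w y) powr p)" for y
      proof (cases "?w y = 0")
        case False
        have "cmod (?w y) powr p = cmod (?w y) powr (p - 2) * (cmod (?w y))\<^sup>2"
          using False powr_add[of "cmod (?w y)" "p - 2" 2] by simp
        then show ?thesis
          using complex_norm_square[of "?w y"] by (simp add: \<Phi>_def mult_ac)
      qed (simp add: \<Phi>_def)
      have \<Phi>_le: "cmod (\<Phi> y) \<le> W powr (p - 1) * indicator (ball 0 R) y" for y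
        unfolding norm_\<Phi> using W p by (auto simp: indicator_def intro!: powr_mono2)
      have \<Phi>: "integrable lborel \<Phi>" "energy \<Phi> < \<infinity>"
        using bounded_ball_supported_integrable[OF \<Phi>_meas \<Phi>_le] by auto
      have int: "integrable lborel (\<lambda>y. indicator (ball 0 R) y * cmod (?w y) powr p)"
      proof -
        have "integrable lborel (\<lambda>y. \<Phi> y * ?w y)" by (rule integrable_mult_bounded[OF \<Phi>(1) bmw])
        then show ?thesis unfolding \<Phi>w by (simp only: complex_of_real_integrable_eq)
      qed
      define I where "I = (\<integral>y. indicator (ball 0 R) y * cmod (?w y) powr p \<partial>lborel)"
      have I: "I \<ge> 0" unfolding I_def by (intro integral_nonneg_AE) auto
      have nnI: "(\<integral>\<^sup>+y. ennreal (indicator (ball 0 R) y * cmod (?w y) powr p) \<partial>lborel) = ennreal I"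
        unfolding I_def by (intro nn_integral_eq_integral int) auto
      have J: "cmod (\<integral>x. \<Phi> x * walk_transform step_weight d l (\<lambda>x. 3 * dbar g x) x \<partial>lborel) \<le> C * 3 powr p * U + 1/2 * I"
        if l: "set l \<subseteq> set walk_round" for d l
      proof -
        have "ennreal (cmod (\<integral>x. \<Phi> x * walk_transform step_weight d l (\<lambda>x. 3 * dbar g x) x \<partial>lborel))
          \<le> (\<integral>\<^sup>+x. ennreal (B (3 * dbar g x) (\<Phi> x)) \<partial>lborel)"
          using l by (intro walk_transform_bilinear_bound B_meas B bmu \<Phi>)
            (auto simp: step_weight_def norm_divide)
        also have "\<dots> \<le> (\<integral>\<^sup>+x. ennreal (C * 3 powr p) * ennreal (cmod (dbar g x) powr p) +
            ennreal (1/2) * ennreal (indicator (ball 0 R) x * cmod (?w x) powr p) \<partial>lborel)"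
        proof (intro nn_integral_mono)
          fix x
          \<comment> \<open>Since (p - 1) q = p, the q-th power of the test function reproduces the
            integrand of I.\<close>
          have "cmod (\<Phi> x) powr q = indicator (ball 0 R) x * cmod (?w x) powr p"
            unfolding norm_\<Phi> using q by (auto simp: indicator_def powr_powr)
          then have "B (3 * dbar g x) (\<Phi> x) \<le> C * 3 powr p * cmod (dbar g x) powr p +
              1/2 * (indicator (ball 0 R) x * cmod (?w x) powr p)"
            using B(3)[of "3 * dbar g x" "\<Phi> x"] by (simp add: norm_mult powr_mult)
          then have "ennreal (B (3 * dbar g x) (\<Phi> x)) \<le> ennreal (C * 3 powr p * cmod (dbar g x) powr p +
              1/2 * (indicator (ball 0 R) x * cmod (?w x) powr p))"
            by (rule ennreal_leI)
          also have "\<dots> = ennreal (C * 3 powr p * cmod (dbar g x) powr p) +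
              ennreal (1/2 * (indicator (ball 0 R) x * cmod (?w x) powr p))"
            using B(2) by (intro ennreal_plus) auto
          also have "\<dots> = ennreal (C * 3 powr p) * ennreal (cmod (dbar g x) powr p) +
              ennreal (1/2) * ennreal (indicator (ball 0 R) x * cmod (?w x) powr p)"
            using B(2) by (intro arg_cong2[where f = "(+)"] ennreal_mult) auto
          finally show "ennreal (B (3 * dbar g x) (\<Phi> x)) \<le> \<dots>" .
        qed
        also have "\<dots> = ennreal (C * 3 powr p) * ennreal U + ennreal (1/2) * ennreal I"
          by (simp only: nn_integral_add[OF borel_measurable_times_ennreal[OF borel_measurable_const m(1)]
                borel_measurable_times_ennreal[OF borel_measurable_const m(2)]] nn_integral_cmult[OF m(1)]
              nn_integral_cmult[OF m(2)] nnI U(2))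
        also have "\<dots> = ennreal (C * 3 powr p * U + 1/2 * I)"
        proof -
          have "ennreal (C * 3 powr p) * ennreal U = ennreal (C * 3 powr p * U)"
            "ennreal (1/2) * ennreal I = ennreal (1/2 * I)"
            using B(2) U(1) I by (intro ennreal_mult[symmetric]; simp)+
          moreover have "C * 3 powr p * U \<ge> 0" "1/2 * I \<ge> 0" using B(2) U(1) I by simp_all
          ultimately show ?thesis by (simp only: ennreal_plus)
        qed
        finally show ?thesis using B(2) U I by (subst (asm) ennreal_le_iff) auto
      qed
      have "cmod (\<integral>x. \<Phi> x * ?w x \<partial>lborel) \<le> C * 3 powr p * U + 1/2 * I"
        by (rule dhol_bilinear_bound[OF g \<Phi> J])
      moreover have "(\<integral>x. \<Phi> x * ?w x \<partial>lborel) = of_real I"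
        unfolding \<Phi>w I_def by (rule integral_complex_of_real)
      ultimately have "I \<le> C' * U" using I by (simp add: C'_def)
      have "(\<integral>\<^sup>+y. ennreal (cmod (?w y) powr p) * indicator (ball 0 R) y \<partial>lborel) = ennreal I"
        unfolding nnI[symmetric] by (intro nn_integral_cong) (auto simp: indicator_def)
      then show ?thesis using \<open>I \<le> C' * U\<close> by (simp add: ennreal_leI)
    qed
    have "(\<integral>\<^sup>+y. ennreal (cmod (?w y) powr p) \<partial>lborel) =
        (\<integral>\<^sup>+y. (SUP n. ennreal (cmod (?w y) powr p) * indicator (ball 0 (real n)) y) \<partial>lborel)"
    proof (intro nn_integral_cong)
      fix y :: "real^2"
      obtain n where "norm y < real n" using reals_Archimedean2 by blast
      then have "ennreal (cmod (?w y) powr p) \<le> (SUP n. ennreal (cmod (?w y) powr p) * indicator (ball 0 (real n)) y)"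
        by (intro SUP_upper2[of n]) auto
      moreover have "(SUP n. ennreal (cmod (?w y) powr p) * indicator (ball 0 (real n)) y) \<le> ennreal (cmod (?w y) powr p)"
        by (intro SUP_least) (auto simp: indicator_def)
      ultimately show "ennreal (cmod (?w y) powr p) = (SUP n. ennreal (cmod (?w y) powr p) * indicator (ball 0 (real n)) y)"
        by (rule antisym)
    qed
    also have "\<dots> = (SUP n. \<integral>\<^sup>+y. ennreal (cmod (?w y) powr p) * indicator (ball 0 (real n)) y \<partial>lborel)"
      by (intro nn_integral_monotone_convergence_SUP)
        (auto simp: incseq_def le_fun_def indicator_def)
    also have "\<dots> \<le> ennreal (C' * U)" by (intro SUP_least ball)
    also have "\<dots> = ennreal C' * ennreal U" using U B(2) by (simp add: C'_def ennreal_mult)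
    finally show ?thesis unfolding U(2) .
  qed
  moreover have "C' > 0" using B(2) by (simp add: C'_def)
  ultimately show ?thesis using that by blast
qed

section \<open>From integrals of p-th powers to norms\<close>

lemma Lp_norm_le:
  assumes p: "0 < p" and c: "0 < c"
    and le: "(\<integral>\<^sup>+y. ennreal (norm (f y) powr p) \<partial>lborel) \<le> ennreal c * (\<integral>\<^sup>+y. ennreal (norm (h y) powr p) \<partial>lborel)"
  shows "Lp_norm p f \<le> ennreal (c powr (1 / p)) * Lp_norm p h"
proof (cases "(\<integral>\<^sup>+y. ennreal (norm (h y) powr p) \<partial>lborel) = \<infinity>")
  case True
  then show ?thesis using c by (simp add: Lp_norm_def Let_def ennreal_mult_top)
next
  case False
  then obtain H where H: "H \<ge> 0" "(\<integral>\<^sup>+y. ennreal (norm (h y) powr p) \<partial>lborel) = ennreal H"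
    by (cases "\<integral>\<^sup>+y. ennreal (norm (h y) powr p) \<partial>lborel") auto
  have le': "(\<integral>\<^sup>+y. ennreal (norm (f y) powr p) \<partial>lborel) \<le> ennreal (c * H)"
    using le H c by (simp add: ennreal_mult)
  then obtain F where F: "F \<ge> 0" "(\<integral>\<^sup>+y. ennreal (norm (f y) powr p) \<partial>lborel) = ennreal F"
    by (cases "\<integral>\<^sup>+y. ennreal (norm (f y) powr p) \<partial>lborel") (auto simp: top_unique)
  have "F \<le> c * H" using le' F H c by simp
  then have "F powr (1 / p) \<le> c powr (1 / p) * H powr (1 / p)"
    using F H c p powr_mono2[of "1 / p" F "c * H"] by (simp add: powr_mult)
  then show ?thesis
    using F H by (simp add: Lp_norm_def Let_def ennreal_mult[symmetric] ennreal_leI)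
qed

text \<open>The partial derivatives are (u + w) / 2 and (u - w) / (2 i) with u =
  \<open>dbar g\<close> and w = \<open>dhol g\<close>. A mean is at most the maximum, whose p-th
  power is at most |w|^p + |u|^p; the second summand turns C into C + 1.\<close>

lemma partial_derivative_Lp_bound:
  assumes p: "1 < p"
  obtains C :: real where "C > 0" "\<And>g k. g \<in> schwartz \<Longrightarrow>
    Lp_norm p (partial_derivative k g) \<le> ennreal C * Lp_norm p (dbar g)"
proof -
  obtain C where C: "C > 0" "\<And>g. g \<in> schwartz \<Longrightarrow>
    (\<integral>\<^sup>+y. ennreal (cmod (dhol g y) powr p) \<partial>lborel) \<le> ennreal C * (\<integral>\<^sup>+y. ennreal (cmod (dbar g y) powr p) \<partial>lborel)"
    using dhol_Lp_bound[OF p] by blast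
  have "Lp_norm p (partial_derivative k g) \<le> ennreal ((C + 1) powr (1 / p)) * Lp_norm p (dbar g)"
    if g: "g \<in> schwartz" for g k
  proof (rule Lp_norm_le)
    have [measurable]: "dhol g \<in> borel_measurable borel" "dbar g \<in> borel_measurable borel"
      using schwartz_bounded_measurable[OF schwartz_dhol[OF g]] schwartz_bounded_measurable[OF schwartz_dbar[OF g]]
      by (simp_all add: bounded_measurable_def)
    have "(\<integral>\<^sup>+y. ennreal (cmod (partial_derivative k g y) powr p) \<partial>lborel) \<le>
      (\<integral>\<^sup>+y. ennreal (cmod (dhol g y) powr p) + ennreal (cmod (dbar g y) powr p) \<partial>lborel)"
    proof (intro nn_integral_mono)
      fix y
      have "2 * partial_derivative 1 g y = dbar g y + dhol g y" "2 * \<i> * partial_derivative 2 g y = dbar g y - dhol g y"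
        by (simp_all add: dbar_def dhol_def algebra_simps)
      then have "2 * cmod (partial_derivative 1 g y) = cmod (dbar g y + dhol g y)"
        "2 * cmod (partial_derivative 2 g y) = cmod (dbar g y - dhol g y)"
        by (metis norm_mult norm_numeral, metis norm_mult norm_numeral norm_ii mult_1_right)
      moreover have "k = 1 \<or> k = 2" using exhaust_2[of k] .
      ultimately have "cmod (partial_derivative k g y) \<le> (cmod (dbar g y) + cmod (dhol g y)) / 2"
        using norm_triangle_ineq[of "dbar g y" "dhol g y"] norm_triangle_ineq4[of "dbar g y" "dhol g y"]
        by auto
      also have "\<dots> \<le> max (cmod (dhol g y)) (cmod (dbar g y))" by (auto simp: max_def)
      finally have "cmod (partial_derivative k g y) powr p \<le> max (cmod (dhol g y)) (cmod (dbar g y)) powr p"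
        using p by (intro powr_mono2) auto
      also have "\<dots> \<le> cmod (dhol g y) powr p + cmod (dbar g y) powr p" by (auto simp: max_def)
      finally show "ennreal (cmod (partial_derivative k g y) powr p) \<le>
          ennreal (cmod (dhol g y) powr p) + ennreal (cmod (dbar g y) powr p)"
        by (simp add: ennreal_leI flip: ennreal_plus)
    qed
    also have "\<dots> = (\<integral>\<^sup>+y. ennreal (cmod (dhol g y) powr p) \<partial>lborel) + (\<integral>\<^sup>+y. ennreal (cmod (dbar g y) powr p) \<partial>lborel)"
      by (rule nn_integral_add) measurable
    also have "\<dots> \<le> ennreal C * (\<integral>\<^sup>+y. ennreal (cmod (dbar g y) powr p) \<partial>lborel) + (\<integral>\<^sup>+y. ennreal (cmod (dbar g y) powr p) \<partial>lborel)"
      by (intro add_right_mono C g)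
    also have "\<dots> = ennreal (C + 1) * (\<integral>\<^sup>+y. ennreal (cmod (dbar g y) powr p) \<partial>lborel)"
      using C(1) by (simp add: distrib_right)
    finally show "(\<integral>\<^sup>+y. ennreal (cmod (partial_derivative k g y) powr p) \<partial>lborel) \<le>
        ennreal (C + 1) * (\<integral>\<^sup>+y. ennreal (cmod (dbar g y) powr p) \<partial>lborel)" .
  qed (use p C in auto)
  then show ?thesis using that[of "(C + 1) powr (1 / p)"] C(1) by simp
qed

theorem theorem4p3:
  fixes \<alpha> :: "real^2" and p :: real
  assumes "\<And>k (m::int). \<alpha> $ k \<noteq> pi * of_int m"
    and "1 < p"
  shows "\<exists>C::real. C > 0 \<and> (\<forall>f \<in> schwartz.
    Lp_norm p (partial_derivative 1 (\<lambda>y. chirp \<alpha> y * f y)) +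
    Lp_norm p (partial_derivative 2 (\<lambda>y. chirp \<alpha> y * f y))
    \<le> ennreal C * Lp_norm p (\<lambda>y.
        inv_chirp \<alpha> y * partial_derivative 1 (\<lambda>y. chirp \<alpha> y * f y) y +
        \<i> * inv_chirp \<alpha> y * partial_derivative 2 (\<lambda>y. chirp \<alpha> y * f y) y))"
proof -
  obtain C where C: "C > 0" "\<And>g k. g \<in> schwartz \<Longrightarrow>
      Lp_norm p (partial_derivative k g) \<le> ennreal C * Lp_norm p (dbar g)"
    using partial_derivative_Lp_bound[OF assms(2)] by blast
  show ?thesis
  proof (intro exI[of _ "C + C"] conjI ballI)
    show "C + C > 0" using C(1) by simp
    fix f :: "real^2 \<Rightarrow> complex" assume "f \<in> schwartz"
    define g where "g = (\<lambda>y. chirp \<alpha> y * f y)"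
    have g: "g \<in> schwartz" unfolding g_def by (rule schwartz_chirp_mult) fact
    have "inv_chirp \<alpha> y * partial_derivative 1 g y + \<i> * inv_chirp \<alpha> y * partial_derivative 2 g y = inv_chirp \<alpha> y * dbar g y" for y
      by (simp add: dbar_def algebra_simps)
    then have eq: "Lp_norm p (\<lambda>y. inv_chirp \<alpha> y * partial_derivative 1 g y + \<i> * inv_chirp \<alpha> y * partial_derivative 2 g y) = Lp_norm p (dbar g)"
      by (simp add: Lp_norm_def norm_mult inv_chirp_def norm_divide norm_chirp)
    have "Lp_norm p (partial_derivative 1 g) + Lp_norm p (partial_derivative 2 g) \<le>
        ennreal C * Lp_norm p (dbar g) + ennreal C * Lp_norm p (dbar g)"
      by (intro add_mono C g)
    also have "\<dots> = ennreal (C + C) * Lp_norm p (dbar g)" 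
      by (simp only: distrib_right ennreal_plus less_imp_le[OF C(1)])
    finally show "Lp_norm p (partial_derivative 1 (\<lambda>y. chirp \<alpha> y * f y)) +
        Lp_norm p (partial_derivative 2 (\<lambda>y. chirp \<alpha> y * f y))
        \<le> ennreal (C + C) * Lp_norm p (\<lambda>y.
        inv_chirp \<alpha> y * partial_derivative 1 (\<lambda>y. chirp \<alpha> y * f y) y +
        \<i> * inv_chirp \<alpha> y * partial_derivative 2 (\<lambda>y. chirp \<alpha> y * f y) y)"
      unfolding g_def[symmetric] eq .
  qed
qed

end
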